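(* Let $\lambda\in(0,1)$ and let $m,n$ be integers with $1\le m\le n-2$. Suppose $E\in\mathcal{A}(\lambda,n,m)$ and let $P(x)=x^{2}-nx+m$. If there is a dust-like self-similar set $F$ such that $E\simeq F$ (Lipschitz equivalence), then there exists an integer $k\ge 2$ such that $$P(x^{k})=x^{2k}-nx^{k}+m$$ is reducible in $\mathbb{Z}[x]$. In particular, $$m\in\{a^{i}\ :\ a\in\mathbb{N},\ i\in\mathbb{N},\ i\ge 2\}.$$
   Context: Self-similar set: a nonempty compact subset $K$ of a Euclidean space with $K=\bigcup_{i=1}^{t}S_i(K)$, where each $S_i$ is a contractive similitude, i.e. $|S_i(x)-S_i(y)|=r_i|x-y|$ for all $x,y$ with $r_i\in(0,1)$. It is called dust-like if the strong separation condition holds: $S_i(K)\cap S_j(K)=\emptyset$ for all $i\ne j$. The class $\mathcal{A}(\lambda,n,m)$ ($\lambda\in(0,1)$, $m,n\in\mathbb{N}$, $1\le m\le n-2$): let $f_i(x)=\lambda x+b_i$ ($1\le i\le n$) with $0=b_1<b_2<\cdots<b_n=1-\lambda$, let $I=[0,1]$ and $I_i=f_i(I)$, and write $|J|$ for the length of an interval $J$. Assume that for $1\le i\le n-1$, whenever $I_i\cap I_{i+1}\ne\emptyset$ one has $|I_i\cap I_{i+1}|/|I_i|\in\{0,\lambda\}$, and that exactly $m$ indices $i$ satisfy $|I_i\cap I_{i+1}|/|I_i|=\lambda$. Then the self-similar set $E\subset\mathbb{R}$ (the unique nonempty compact set) with $E=\bigcup_{i=1}^{n}f_i(E)$ is said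 to belong to $\mathcal{A}(\lambda,n,m)$. Lipschitz equivalence: compact subsets $X_1,X_2$ of Euclidean spaces satisfy $X_1\simeq X_2$ if there are a bijection $f:X_1\to X_2$ and a constant $C>0$ with $C^{-1}|x-y|\le|f(x)-f(y)|\le C|x-y|$ for all $x,y\in X_1$. $\mathbb{N}$ denotes the positive integers. *)

theory Defs
  imports "HOL-Analysis.Analysis" "HOL-Computational_Algebra.Computational_Algebra"
begin

definition contractive_similitude :: "('a::metric_space \<Rightarrow> 'a) \<Rightarrow> bool" where
  "contractive_similitude S \<longleftrightarrow>
     (\<exists>r. 0 < r \<and> r < 1 \<and> (\<forall>x y. dist (S x) (S y) = r * dist x y))"

definition attractor :: "nat \<Rightarrow> (nat \<Rightarrow> 'a \<Rightarrow> 'a) \<Rightarrow> 'a::topological_space set \<Rightarrow> bool" where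
  "attractor t S K \<longleftrightarrow> compact K \<and> K \<noteq> {} \<and> K = (\<Union>i\<in>{1..t}. S i ` K)"

definition dust_like_self_similar :: "'a::euclidean_space set \<Rightarrow> bool" where
  "dust_like_self_similar K \<longleftrightarrow>
     (\<exists>t S. (\<forall>i\<in>{1..t}. contractive_similitude (S i)) \<and> attractor t S K \<and>
        (\<forall>i\<in>{1..t}. \<forall>j\<in>{1..t}. i \<noteq> j \<longrightarrow> S i ` K \<inter> S j ` K = {}))"

definition lipschitz_equivalent :: "'a::metric_space set \<Rightarrow> 'b::metric_space set \<Rightarrow> bool" where
  "lipschitz_equivalent X Y \<longleftrightarrow>
     (\<exists>f C. C > 0 \<and> bij_betw f X Y \<and>
        (\<forall>x\<in>X. \<forall>y\<in>X. inverse C * dist x y \<le> dist (f x) (f y) \<and>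
                      dist (f x) (f y) \<le> C * dist x y))"

definition affine_map :: "real \<Rightarrow> (nat \<Rightarrow> real) \<Rightarrow> nat \<Rightarrow> real \<Rightarrow> real" where
  "affine_map l b i x = l * x + b i"

definition basic_interval :: "real \<Rightarrow> (nat \<Rightarrow> real) \<Rightarrow> nat \<Rightarrow> real set" where
  "basic_interval l b i = affine_map l b i ` {0..1}"

definition overlap_ratio :: "real \<Rightarrow> (nat \<Rightarrow> real) \<Rightarrow> nat \<Rightarrow> real" where
  "overlap_ratio l b i =
     measure lborel (basic_interval l b i \<inter> basic_interval l b (Suc i))
       / measure lborel (basic_interval l b i)"

definition class_A :: "real \<Rightarrow> nat \<Rightarrow> nat \<Rightarrow> real set set" where
  "class_A l n m = {E. \<exists>b :: nat \<Rightarrow> real.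
     b 1 = 0 \<and> b n = 1 - l \<and> strict_mono_on {1..n} b \<and>
     (\<forall>i\<in>{1..<n}. basic_interval l b i \<inter> basic_interval l b (Suc i) \<noteq> {}
        \<longrightarrow> overlap_ratio l b i \<in> {0, l}) \<and>
     card {i \<in> {1..<n}. overlap_ratio l b i = l} = m \<and>
     attractor n (affine_map l b) E}"

definition P_poly :: "nat \<Rightarrow> nat \<Rightarrow> int poly" where
  "P_poly n m = [:int m, - int n, 1:]"

end

theory Submission
  imports Defs
begin

text \<open>
  Write \<open>\<theta>\<^sub>1 > \<theta>\<^sub>2\<close> for the roots of \<open>P(x) = x^2 - n x + m\<close>; the condition
  \<open>1 \<le> m \<le> n - 2\<close> gives \<open>P(1) < 0\<close>, hence \<open>\<theta>\<^sub>1 > 1 > \<theta>\<^sub>2 > 0\<close>. Let \<open>\<rho> = 1/\<theta>\<^sub>1\<close>, which is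
  \<open>l^s\<close> for the dimension \<open>s\<close> of \<open>E\<close>. The proof transports the natural mass of \<open>E\<close> to the dust-like
  set \<open>F\<close> and reads off an algebraic identity for \<open>\<rho>\<close>.

  \<^item> The mass on \<open>E\<close> is obtained by counting. Let \<open>ends j\<close> be the set of left endpoints of the
    intervals \<open>f\<^sub>u [0,1]\<close> over the words \<open>u\<close> of length \<open>j\<close>. Two overlapping neighbours at any level share
    precisely one interval of the next level, so inclusion--exclusion counts endpoints and
    \<open>card (ends (j + 2)) = n card (ends (j + 1)) - m card (ends j)\<close>. Hence
    \<open>\<rho>^j card (ends j)\<close> converges, and so does \<open>\<rho>^j card (ends j \<inter> A)\<close> for every union \<open>A\<close> of pieces
    of level \<open>k\<close>; its limit is a constant times \<open>\<rho>^k (p - q \<rho>)\<close>, where \<open>p\<close> counts the endpoints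
    of level \<open>k\<close> in \<open>A\<close> and \<open>q\<close> those among them whose interval is overlapped on the right
    (\<open>saturated_measure\<close>).

  \<^item> Let \<open>h : E \<rightarrow> F\<close> be bi-Lipschitz. By strong separation the preimage of the piece \<open>F\<^sub>w\<close> of \<open>F\<close> with
    contraction ratio \<open>r\<^sub>w\<close> is a union of pieces of a level \<open>k\<close> with \<open>l^k\<close> comparable to \<open>r\<^sub>w\<close>, and its
    diameter is at most of the order of \<open>r\<^sub>w\<close>. So \<open>p\<close> and \<open>q\<close> stay bounded, and the mass of the preimage is
    \<open>\<rho>^k v\<close> with \<open>v\<close> in a fixed finite set of positive numbers. This mass is comparable to \<open>r\<^sub>w^s\<close>.

  \<^item> Additivity, comparability and finiteness force rigidity (locale \<open>discrete_mass\<close>): the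
    ratio of \<open>r\<^sub>w^s\<close> to the mass changes by finitely many factors from a piece to its children, so below
    a word where it is close to its supremum it cannot increase, and being an average it is
    constant there. Comparing the words obtained by repeating a letter \<open>i\<close>, two of the values \<open>v\<close>
    coincide, and therefore \<open>(r\<^sub>i^s)^p = \<rho>^e\<close> with \<open>p \<ge> 1\<close>; moreover \<open>\<Sum>\<^sub>i r\<^sub>i^s = 1\<close>.

  \<^item> With a common exponent \<open>k\<close> this says \<open>\<Sum>\<^sub>i y^(-f\<^sub>i) = 1\<close> for \<open>y = \<theta>\<^sub>1^(1/k)\<close> and positive integers
    \<open>f\<^sub>i\<close>. If \<open>P(x^k)\<close> were irreducible, all its roots would satisfy the same equation, in
    particular the positive root \<open>\<theta>\<^sub>2^(1/k) < 1\<close>, for which every summand exceeds \<open>1\<close>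
    (\<open>reducible_of_power_sum\<close>). One may take \<open>k\<close> even, so \<open>k \<ge> 2\<close>.

  \<^item> A proper factor \<open>A\<close> of \<open>P(x^k)\<close> has \<open>|A(0)|^k = \<theta>\<^sub>1^a \<theta>\<^sub>2^b\<close> with \<open>a + b = deg A < 2 k\<close>. As this is
    an integer and no positive power of \<open>\<theta>\<^sub>1\<close> or \<open>\<theta>\<^sub>2\<close> is rational, \<open>a = b\<close>, so \<open>m^a = |A(0)|^k\<close> with \<open>0 < a < k\<close>, which
    makes \<open>m\<close> a perfect power (\<open>perfect_power_of_reducible\<close>).
\<close>

section \<open>Integer polynomials with a common root\<close>

abbreviation eval_int :: "int poly \<Rightarrow> 'a::comm_ring_1 \<Rightarrow> 'a" where
  "eval_int p x \<equiv> poly (map_poly of_int p) x"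

lemma map_poly_of_int_add:
  "map_poly (of_int :: int \<Rightarrow> 'a::comm_ring_1) (p + q) = map_poly of_int p + map_poly of_int q"
  by (rule poly_eqI) (simp add: coeff_map_poly)

lemma map_poly_of_int_mult:
  "map_poly (of_int :: int \<Rightarrow> 'a::comm_ring_1) (p * q) = map_poly of_int p * map_poly of_int q"
  by (rule poly_eqI) (simp add: coeff_map_poly coeff_mult)

lemma eval_int_add: "eval_int (p + q) x = eval_int p x + eval_int q x"
  by (simp add: map_poly_of_int_add)

lemma eval_int_mult: "eval_int (p * q) x = eval_int p x * eval_int q x"
  by (simp add: map_poly_of_int_mult)

lemma eval_int_uminus: "eval_int (- p) x = - eval_int p x"
proof -
  have "eval_int p x + eval_int (- p) x = 0"
    unfolding eval_int_add [symmetric] by simp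
  then show ?thesis
    by (metis add.inverse_unique)
qed

lemma eval_int_diff: "eval_int (p - q) x = eval_int p x - eval_int q x"
  using eval_int_add[of p "- q" x] by (simp add: eval_int_uminus)

lemma eval_int_sum: "eval_int (\<Sum>i\<in>I. p i) x = (\<Sum>i\<in>I. eval_int (p i) x)"
  by (induction I rule: infinite_finite_induct) (simp_all add: eval_int_add)

lemma eval_int_monom: "eval_int (monom c k) x = of_int c * x ^ k"
  by (simp add: map_poly_monom poly_monom)

lemma eval_int_smult: "eval_int (smult c p) x = of_int c * eval_int p x"
  using eval_int_mult[of "[:c:]" p x] by (simp add: map_poly_pCons)

lemma eval_int_pcompose_monom:
  "eval_int (pcompose p (monom 1 k)) x = eval_int p (x ^ k)"
proof (induction p)
  case 0
  then show ?case by simp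
next
  case (pCons a p)
  then show ?case
    by (simp add: pcompose_pCons eval_int_add eval_int_mult eval_int_monom map_poly_pCons)
qed

text \<open>
  Gauss's lemma in the form needed to pass from divisibility up to an integer factor, which is all that
  pseudo-division yields, to divisibility over the integers.
\<close>

lemma dvd_of_primitive_dvd_smult:
  fixes g h :: "int poly"
  assumes "content g = 1" "a \<noteq> 0" "g dvd smult a h"
  shows "g dvd h"
proof -
  obtain q where q: "smult a h = g * q"
    using assms(3) by (auto simp: dvd_def)
  have "smult (unit_factor a) (primitive_part h) = primitive_part (smult a h)"
    by (simp add: primitive_part_smult)
  also have "\<dots> = primitive_part g * primitive_part q"
    by (simp add: q primitive_part_mult)
  also have "primitive_part g = g"
    using assms(1) by (simp add: primitive_part_prim)
  finally have "g dvd smult (unit_factor a) (primitive_part h)"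
    by simp
  then have "g dvd smult (sgn a) (smult (sgn a) (primitive_part h))"
    by (simp only: unit_factor_int_def dvd_smult)
  then have "g dvd primitive_part h"
    using assms(2) by (simp add: sgn_if split: if_splits)
  then have "g dvd smult (content h) (primitive_part h)"
    by (rule dvd_smult)
  then show ?thesis
    by simp
qed

text \<open>
  An integer polynomial \<open>h\<close> of least degree vanishing at \<open>y\<close> divides every other one up to an integer
  factor, since a pseudo-remainder would vanish at \<open>y\<close> and have smaller degree. Hence the primitive part
  \<open>p\<close> of \<open>h\<close> divides both \<open>f\<close> and \<open>g\<close>, and irreducibility makes \<open>f\<close> an associate of \<open>p\<close>.
\<close>

lemma irreducible_dvd_of_common_root:
  fixes f g :: "int poly" and y :: real
  assumes f: "irreducible f" and fy: "eval_int f y = 0" and gy: "eval_int g y = 0"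
  shows "f dvd g"
proof -
  let ?R = "\<lambda>h. h \<noteq> 0 \<and> eval_int h y = 0"
  have "?R f"
    using f fy by (auto simp: irreducible_def)
  then obtain h where h: "?R h" and hmin: "\<And>k. ?R k \<Longrightarrow> degree h \<le> degree k"
    using ex_has_least_nat[of ?R f degree] by blast
  define p where "p = primitive_part h"
  have hp: "h = smult (content h) p"
    by (simp add: p_def)
  have pc: "content p = 1"
    using h by (simp add: p_def)
  have py: "eval_int p y = 0"
    using h arg_cong[OF hp, of "\<lambda>k. eval_int k y"]
    by (metis content_eq_zero_iff eval_int_smult mult_eq_0_iff of_int_eq_0_iff)
  have p_dvd: "p dvd k" if k: "eval_int k y = 0" for k
  proof -
    obtain a q where a: "a \<noteq> 0" and eq: "smult a k = h * q + pseudo_mod k h"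
      using pseudo_mod(1)[of h k] h by auto
    have "eval_int (pseudo_mod k h) y = 0"
      using arg_cong[OF eq, of "\<lambda>k. eval_int k y"] h k
      by (simp add: eval_int_smult eval_int_add eval_int_mult)
    then have "pseudo_mod k h = 0"
      using pseudo_mod(2)[of h k] h hmin[of "pseudo_mod k h"] by (metis not_le)
    then have "h dvd smult a k"
      using eq by auto
    then have "p dvd smult a k"
      by (metis hp dvd_smult_cancel dvd_trans dvd_smult dvd_refl)
    then show ?thesis
      using pc a dvd_of_primitive_dvd_smult by blast
  qed
  obtain c where c: "f = p * c"
    using p_dvd[OF fy] by (auto simp: dvd_def)
  have "\<not> is_unit p"
  proof
    assume "is_unit p"
    then obtain q where "1 = p * q"
      by (rule dvdE)
    then have "eval_int p y * eval_int q y = 1"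
      using eval_int_mult[of p q y] by simp
    then show False
      using py by simp
  qed
  then have "is_unit c"
    using f c by (auto simp: irreducible_def)
  then have "f dvd p"
    using c by (simp add: mult_unit_dvd_iff)
  then show ?thesis
    using p_dvd[OF gy] by (rule dvd_trans)
qed

lemma monic_reducible_factor:
  fixes f :: "int poly"
  assumes "lead_coeff f = 1" "degree f > 0" "\<not> irreducible f"
  obtains A B where "f = A * B" "0 < degree A" "degree A < degree f" "\<bar>lead_coeff A\<bar> = 1"
proof -
  have "f \<noteq> 0" "\<not> is_unit f"
    using assms by (auto simp: is_unit_poly_iff)
  then obtain A B where AB: "f = A * B" "\<not> is_unit A" "\<not> is_unit B"
    using assms(3) by (auto simp: irreducible_def)
  have lc: "lead_coeff A * lead_coeff B = 1"
    using assms(1) AB by (simp add: lead_coeff_mult)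
  then have lA: "\<bar>lead_coeff A\<bar> = 1" and lB: "\<bar>lead_coeff B\<bar> = 1"
    using abs_zmult_eq_1[of "lead_coeff A" "lead_coeff B"] abs_zmult_eq_1[of "lead_coeff B" "lead_coeff A"]
    by (simp_all add: mult.commute)
  have unit: "is_unit C" if "\<bar>lead_coeff C\<bar> = 1" "degree C = 0" for C :: "int poly"
  proof -
    obtain c where "C = [:c:]"
      using \<open>degree C = 0\<close> by (rule degree_eq_zeroE)
    then show ?thesis
      using that by (simp add: is_unit_const_poly_iff)
  qed
  \<comment> \<open>A constant factor has leading coefficient \<open>1\<close> or \<open>-1\<close> and would be a unit.\<close>
  have "degree A \<noteq> 0" "degree B \<noteq> 0"
    using unit lA lB AB by blast+
  moreover have "degree f = degree A + degree B"
    using AB \<open>f \<noteq> 0\<close> by (metis degree_mult_eq mult_zero_left mult_zero_right)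
  ultimately show thesis
    using that AB lA by simp
qed

text \<open>
  Used for the roots of a factor of \<open>P(x^k)\<close>, whose absolute values have only two possible \<open>k\<close>-th powers.
\<close>

lemma prod_mset_two_values:
  fixes M :: "'b multiset" and g :: "'b \<Rightarrow> 'c::comm_monoid_mult"
  assumes "\<And>x. x \<in># M \<Longrightarrow> g x = u \<or> g x = v"
  shows "\<exists>a b. a + b = size M \<and> (\<Prod>x\<in>#M. g x) = u ^ a * v ^ b"
  using assms
proof (induction M)
  case empty
  then show ?case by simp
next
  case (add x M)
  then obtain a b where ab: "a + b = size M" "(\<Prod>x\<in>#M. g x) = u ^ a * v ^ b"
    by auto
  have "g x = u \<or> g x = v"
    using add.prems by simp
  then show ?case
  proof
    assume "g x = u"
    then show ?thesis
      using ab by (intro exI[of _ "Suc a"] exI[of _ b]) (simp add: ac_simps)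
  next
    assume "g x = v"
    then show ?thesis
      using ab by (intro exI[of _ a] exI[of _ "Suc b"]) (simp add: ac_simps)
  qed
qed

section \<open>The quadratic polynomial and reducibility of its power substitutions\<close>

locale quadratic_roots =
  fixes n m :: nat and big small :: real
  assumes m: "1 \<le> m" "m + 2 \<le> n"
    and roots_sum: "big + small = real n" and roots_prod: "big * small = real m"
    and big: "1 < big" and small: "0 < small" "small < 1"

lemma quadratic_roots_exist:
  fixes n m :: nat
  assumes m: "1 \<le> m" "m + 2 \<le> n"
  obtains big small where "quadratic_roots n m big small"
proof -
  define d where "d = sqrt (real n ^ 2 - 4 * real m)"
  have nm: "real m + 2 \<le> real n" "1 \<le> real m"
    using m by linarith+
  then have n2: "(real n - 2)\<^sup>2 < real n ^ 2 - 4 * real m" "real n ^ 2 - 4 * real m < (real n)\<^sup>2"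
    by (auto simp: power2_eq_square algebra_simps)
  then have d1: "real n - 2 < d" "d < real n"
    using real_less_rsqrt real_less_lsqrt[of "real n" "real n ^ 2 - 4 * real m"] nm
      real_sqrt_less_iff[of "real n ^ 2 - 4 * real m" "(real n)\<^sup>2"]
    unfolding d_def by auto
  have dd: "d * d = real n ^ 2 - 4 * real m"
    unfolding d_def using order.strict_trans1[OF zero_le_power2 n2(1)] by simp
  have "quadratic_roots n m ((real n + d) / 2) ((real n - d) / 2)"
  proof
    show "(real n + d) / 2 * ((real n - d) / 2) = real m"
      using dd by (simp add: field_simps power2_eq_square)
  qed (use m nm d1 in \<open>auto simp: field_simps\<close>)
  then show thesis
    using that by blast
qed

context quadratic_roots
begin

lemma P_eval: "eval_int (P_poly n m) x = (x - big) * (x - small)" for x :: real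
  unfolding P_poly_def using roots_sum[symmetric] roots_prod[symmetric]
  by (simp add: map_poly_pCons algebra_simps)

lemma P_power_eval:
  "eval_int (pcompose (P_poly n m) (monom 1 k)) x = (x ^ k - big) * (x ^ k - small)" for x :: real
  by (simp add: eval_int_pcompose_monom P_eval)

lemma P_power_degree: "degree (pcompose (P_poly n m) (monom 1 k)) = 2 * k"
  by (simp add: P_poly_def degree_pcompose degree_monom_eq)

lemma P_power_monic: "k \<ge> 1 \<Longrightarrow> lead_coeff (pcompose (P_poly n m) (monom 1 k)) = 1"
  by (subst lead_coeff_comp) (auto simp: P_poly_def degree_monom_eq)

text \<open>
  A rational root would be an integer \<open>z\<close> with \<open>z (n - z) = m > 0\<close>, so both factors are at least \<open>1\<close>
  and \<open>(z - 1) (n - z - 1) \<ge> 0\<close>; but this product equals \<open>m - n + 1 < 0\<close>.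
\<close>

lemma P_irreducible: "irreducible (P_poly n m)"
proof (rule ccontr)
  assume "\<not> irreducible (P_poly n m)"
  moreover have "degree (P_poly n m) = 2" "lead_coeff (P_poly n m) = 1"
    by (simp_all add: P_poly_def)
  ultimately obtain A B where AB: "P_poly n m = A * B" and dA: "degree A = 1"
    and lA: "\<bar>lead_coeff A\<bar> = 1"
    using monic_reducible_factor[of "P_poly n m"] by (smt (verit) One_nat_def less_2_cases_iff not_gr0 zero_less_numeral)
  obtain c e where A: "A = [:c, e:]"
    using dA degree1_coeffs by metis
  then have e: "\<bar>e\<bar> = 1"
    using lA dA by (auto split: if_splits)
  define z where "z = - c * e"
  have "e * e = 1"
    using e by (metis abs_mult_self_eq mult_1)
  then have "poly A z = 0"
    by (simp add: A z_def algebra_simps) 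
  then have "poly (P_poly n m) z = 0"
    using AB by simp
  then have z: "z * (int n - z) = int m"
    by (simp add: P_poly_def algebra_simps)
  then have "z * (int n - z) > 0"
    using m by simp
  then have "z \<ge> 1" "int n - z \<ge> 1"
    using m by (auto simp: zero_less_mult_iff)
  then have "(z - 1) * (int n - z - 1) \<ge> 0"
    by simp
  moreover have "(z - 1) * (int n - z - 1) = int m - int n + 1"
    using z by (simp add: algebra_simps)
  ultimately show False
    using m by simp
qed

text \<open>
  Clearing denominators in \<open>\<Sum>\<^sub>i x^(-e\<^sub>i) = 1\<close> gives an integer polynomial \<open>G\<close> with root \<open>y\<close>. An
  irreducible \<open>P(x^k)\<close> would divide \<open>G\<close>, so \<open>G\<close> would also vanish at the \<open>k\<close>-th root of the small root.
  But \<open>\<Sum>\<^sub>i x^(-e\<^sub>i)\<close> is strictly decreasing on the positive axis, so it takes the value \<open>1\<close> only once.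
\<close>

lemma reducible_of_power_sum:
  assumes I: "finite I" "I \<noteq> {}" and e: "\<And>i. i \<in> I \<Longrightarrow> e i \<ge> (1::nat)"
    and k: "k \<ge> 1" and y: "y > 0" "y ^ k = big" and sum1: "(\<Sum>i\<in>I. (1 / y) ^ e i) = 1"
  shows "\<not> irreducible (pcompose (P_poly n m) (monom 1 k))"
proof
  let ?f = "pcompose (P_poly n m) (monom 1 k)"
  assume irr: "irreducible ?f"
  define Q where "Q = (\<Sum>i\<in>I. e i)"
  define G :: "int poly" where "G = monom 1 Q - (\<Sum>i\<in>I. monom 1 (Q - e i))"
  have G: "eval_int G x = x ^ Q * (1 - (\<Sum>i\<in>I. (1 / x) ^ e i))" if "x > 0" for x :: real
  proof -
    have "x ^ (Q - e i) = x ^ Q * (1 / x) ^ e i" if "i \<in> I" for i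
    proof -
      have "e i \<le> Q"
        unfolding Q_def using I(1) that by (intro member_le_sum) auto
      then show ?thesis
        using \<open>x > 0\<close> by (simp add: power_diff power_one_over)
    qed
    then show ?thesis
      unfolding G_def by (simp add: eval_int_diff eval_int_sum eval_int_monom sum_distrib_left algebra_simps)
  qed
  have "?f dvd G"
    using irr
  proof (rule irreducible_dvd_of_common_root)
    show "eval_int ?f y = 0"
      by (simp add: P_power_eval y)
    show "eval_int G y = 0"
      using y sum1 by (simp add: G)
  qed
  define x where "x = root k small"
  have x: "x > 0" "x ^ k = small" "x < 1"
    using small k by (auto simp: x_def real_root_lt_1_iff)
  have "eval_int ?f x = 0"
    by (simp add: P_power_eval x)
  then have "eval_int G x = 0"
    using \<open>?f dvd G\<close> by (auto simp: dvd_def eval_int_mult)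
  then have "(\<Sum>i\<in>I. (1 / x) ^ e i) = 1"
    using x by (simp add: G)
  moreover have "(\<Sum>i\<in>I. (1::real)) < (\<Sum>i\<in>I. (1 / x) ^ e i)"
  proof (rule sum_strict_mono[OF I])
    fix i assume "i \<in> I"
    then have "e i > 0"
      using e[of i] by simp
    then show "(1::real) < (1 / x) ^ e i"
      using x by (intro one_less_power) auto
  qed
  moreover have "real (card I) \<ge> 1"
    using I card_gt_0_iff[of I] by linarith
  moreover have "(\<Sum>i\<in>I. (1::real)) = real (card I)"
    by simp
  ultimately show False
    by linarith
qed

text \<open>
  If a power of one root of \<open>P\<close> were rational, irreducibility of \<open>P\<close> would give the other root the same
  power, whereas the roots are positive and distinct.
\<close>

lemma root_power_irrational:
  assumes N: "real N = real m ^ c * z ^ d" and z: "z = big \<or> z = small" and d: "d > 0"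
  shows False
proof -
  define G :: "int poly" where "G = smult (int m ^ c) (monom 1 d) - [:int N:]"
  have G: "eval_int G x = real m ^ c * x ^ d - real N" for x :: real
    by (simp add: G_def eval_int_diff eval_int_smult eval_int_monom map_poly_pCons)
  have "P_poly n m dvd G"
    using P_irreducible
    by (rule irreducible_dvd_of_common_root[where y = z]) (use N z in \<open>auto simp: G P_eval\<close>)
  then have "eval_int G big = 0" "eval_int G small = 0"
    by (auto simp: dvd_def eval_int_mult P_eval)
  then have "real m ^ c * big ^ d = real m ^ c * small ^ d"
    by (simp add: G)
  then have "big ^ d = small ^ d"
    using m by simp
  moreover have "small ^ d < big ^ d"
    using big small d by (intro power_strict_mono) auto
  ultimately show False
    by simp
qed

text \<open>
  Up to sign the constant term is the product of the complex roots of \<open>A\<close>. Each root \<open>x\<close> satisfies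
  \<open>P(x^k) = 0\<close>, so the \<open>k\<close>-th power of the product is a product of roots of \<open>P\<close>.
\<close>

lemma constant_term_of_factor:
  fixes A B :: "int poly"
  assumes AB: "pcompose (P_poly n m) (monom 1 k) = A * B" and lA: "\<bar>lead_coeff A\<bar> = 1"
  obtains a b where "a + b = degree A" "real (nat \<bar>coeff A 0\<bar>) ^ k = big ^ a * small ^ b"
proof -
  define Ac :: "complex poly" where "Ac = map_poly of_int A"
  have dAc: "degree Ac = degree A"
    unfolding Ac_def by (rule degree_map_poly) simp
  have lAc: "norm (lead_coeff Ac) = 1"
    using lA unfolding dAc by (simp add: Ac_def coeff_map_poly flip: of_int_abs)
  have norm_root: "norm x ^ k = big \<or> norm x ^ k = small" if "x \<in># proots Ac" for x
  proof -
    have "poly Ac x = 0"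
      using that by (cases "Ac = 0") auto
    then have "eval_int (pcompose (P_poly n m) (monom 1 k)) x = 0"
      unfolding AB by (simp add: eval_int_mult Ac_def)
    then have "eval_int (P_poly n m) (x ^ k) = 0"
      by (simp add: eval_int_pcompose_monom)
    then have "(x ^ k - of_real big) * (x ^ k - of_real small) = 0"
      unfolding P_poly_def using roots_sum[THEN arg_cong, of complex_of_real] roots_prod[THEN arg_cong, of complex_of_real]
      by (simp add: map_poly_pCons algebra_simps) (metis distrib_left mult.commute)
    then have "x ^ k = of_real big \<or> x ^ k = of_real small"
      by simp
    then have "norm (x ^ k) = \<bar>big\<bar> \<or> norm (x ^ k) = \<bar>small\<bar>"
      by (metis norm_of_real)
    then show ?thesis
      using big small by (simp add: norm_power)
  qed
  obtain a b where ab: "a + b = size (proots Ac)"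
    "(\<Prod>x\<in>#proots Ac. norm x ^ k) = big ^ a * small ^ b"
    using prod_mset_two_values[of "proots Ac" "\<lambda>x. norm x ^ k" big small] norm_root by blast
  have norm_prod: "norm (\<Prod>x\<in>#M. - x) ^ k = (\<Prod>x\<in>#M. norm x ^ k)" for M :: "complex multiset"
    by (induction M) (simp_all add: norm_mult power_mult_distrib)
  have poly_prod: "poly (\<Prod>x\<in>#M. [:- x, 1:]) 0 = (\<Prod>x\<in>#M. - x)" for M :: "complex multiset"
    by (induction M) simp_all
  have "poly Ac 0 = lead_coeff Ac * (\<Prod>x\<in>#proots Ac. - x)"
    by (subst complex_poly_decompose_multiset[of Ac, symmetric]) (simp only: poly_smult poly_prod)
  then have "norm (poly Ac 0) ^ k = big ^ a * small ^ b"
    using ab(2) lAc by (simp add: norm_mult norm_prod)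
  moreover have "norm (poly Ac 0) = real (nat \<bar>coeff A 0\<bar>)"
    by (simp add: Ac_def poly_0_coeff_0 coeff_map_poly)
  ultimately show thesis
    using that ab by (simp add: size_proots_complex dAc)
qed

end

text \<open>
  After division of the exponents by \<open>gcd a k\<close>, the prime multiplicities of \<open>m\<close> are divisible by
  \<open>k / gcd a k\<close>, which exceeds \<open>1\<close> because \<open>a < k\<close>.
\<close>

lemma perfect_power_of_power_eq:
  fixes m c a k :: nat
  assumes eq: "m ^ a = c ^ k" and a: "0 < a" "a < k" and m: "m \<ge> 1"
  shows "\<exists>e i. m = e ^ i \<and> e \<ge> 1 \<and> i \<ge> 2"
proof -
  define g where "g = gcd a k"
  define i where "i = k div g"
  have g: "g > 0" "g dvd a" "g dvd k"
    using a by (auto simp: g_def)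
  have "g \<le> a"
    using g a by (simp add: dvd_imp_le)
  have ik: "k = g * i"
    using g by (simp add: i_def)
  have c: "c \<noteq> 0"
    using eq m a by (intro notI) (simp add: zero_power)
  have i2: "i \<ge> 2"
  proof (rule ccontr)
    assume "\<not> i \<ge> 2"
    then have "i \<le> 1"
      by simp
    then have "k \<le> g"
      using ik by (metis mult_le_mono2 mult.right_neutral)
    then show False
      using \<open>g \<le> a\<close> a by simp
  qed
  have "i dvd multiplicity p m" if p: "prime p" for p
  proof -
    have "a * multiplicity p m = k * multiplicity p c"
      using arg_cong[OF eq, of "multiplicity p"] p m c
      by (simp add: prime_elem_multiplicity_power_distrib)
    then have "g * (a div g * multiplicity p m) = g * (i * multiplicity p c)"
      using g ik by (simp add: mult.assoc[symmetric])
    then have "(a div g) * multiplicity p m = i * multiplicity p c"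
      using g by simp
    then have "i dvd (a div g) * multiplicity p m"
      by simp
    moreover have "coprime i (a div g)"
      unfolding i_def g_def using a div_gcd_coprime[of k a] by (simp add: gcd.commute)
    ultimately show ?thesis
      by (simp add: coprime_dvd_mult_right_iff)
  qed
  then have "is_nth_power i m"
    using i2 by (subst is_nth_power_conv_multiplicity_nat) auto
  then obtain e where "m = e ^ i"
    by (auto elim: is_nth_powerE)
  moreover from this have "e \<noteq> 0"
    using i2 m by (intro notI) (simp add: zero_power)
  ultimately show ?thesis
    using i2 by (intro exI[of _ e] exI[of _ i]) simp
qed

text \<open>
  The constant term of a proper factor has \<open>k\<close>-th power \<open>big^a small^b\<close>. If \<open>a \<noteq> b\<close>, then splitting off
  \<open>(big small)^min a b = m^min a b\<close> would leave a rational power of a single root.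
\<close>

lemma (in quadratic_roots) perfect_power_of_reducible:
  assumes k: "k \<ge> 1" and red: "\<not> irreducible (pcompose (P_poly n m) (monom 1 k))"
  shows "\<exists>e i. m = e ^ i \<and> e \<ge> 1 \<and> i \<ge> 2"
proof -
  let ?f = "pcompose (P_poly n m) (monom 1 k)"
  obtain A B where AB: "?f = A * B" and dA: "0 < degree A" "degree A < 2 * k"
    and lA: "\<bar>lead_coeff A\<bar> = 1"
  proof (rule monic_reducible_factor[OF P_power_monic[OF k] _ red])
    show "0 < degree ?f"
      using k by (simp add: P_power_degree)
  qed (use that P_power_degree in metis)
  obtain a b where ab: "a + b = degree A" and c: "real (nat \<bar>coeff A 0\<bar>) ^ k = big ^ a * small ^ b"
    using constant_term_of_factor[OF AB lA] .
  define N where "N = nat \<bar>coeff A 0\<bar> ^ k"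
  have N: "real N = big ^ a * small ^ b"
    using c by (simp add: N_def)
  have "a = b"
  proof (rule linorder_cases[of a b])
    assume "a < b"
    then have "real N = real m ^ a * small ^ (b - a)"
      by (simp add: N roots_prod[symmetric] power_mult_distrib power_add[symmetric])
    then show ?thesis
      using root_power_irrational[of N a small "b - a"] \<open>a < b\<close> by simp
  next
    assume "b < a"
    then have "real N = real m ^ b * big ^ (a - b)"
      by (simp add: N roots_prod[symmetric] power_mult_distrib power_add[symmetric] algebra_simps)
    then show ?thesis
      using root_power_irrational[of N b big "a - b"] \<open>b < a\<close> by simp
  qed
  then have "real N = real m ^ a"
    by (simp add: N roots_prod[symmetric] power_mult_distrib)
  then have "m ^ a = nat \<bar>coeff A 0\<bar> ^ k"
    unfolding N_def by (metis of_nat_eq_iff of_nat_power)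
  moreover have "0 < a" "a < k"
    using ab dA \<open>a = b\<close> by auto
  ultimately show ?thesis
    using perfect_power_of_power_eq m by blast
qed

section \<open>Masses with finitely many shapes on a tree of words\<close>

text \<open>
  By the pigeonhole principle \<open>v\<close> takes the same value at two indices; the quotient of the two
  equations expresses a power of \<open>a\<close> as a power of \<open>\<rho>\<close>.
\<close>

lemma commensurable_of_finite_quotients:
  fixes a \<rho> :: real and K :: "nat \<Rightarrow> nat" and v :: "nat \<Rightarrow> real"
  assumes V: "finite V" "\<And>N. v N \<in> V" "\<And>x. x \<in> V \<Longrightarrow> x > 0" and a: "a > 0" and \<rho>: "0 < \<rho>"
    and K: "mono K"
    and eq: "\<And>N. \<rho> ^ K N * v N = C * a ^ N" and C: "C > 0"
  shows "\<exists>p\<ge>1. \<exists>e. a ^ p = \<rho> ^ e"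
proof -
  have "\<not> inj v"
  proof
    assume "inj v"
    moreover have "finite (range v)"
      using V by (auto intro: finite_subset)
    ultimately show False
      using finite_imageD infinite_UNIV_nat by blast
  qed
  then obtain x y where xy: "v x = v y" "x \<noteq> y"
    unfolding inj_def by blast
  define M N where "M = min x y" and "N = max x y"
  have MN: "v M = v N" "M < N"
    using xy by (auto simp: M_def N_def min_def max_def)
  have KMN: "K M \<le> K N"
    using monoD[OF K] MN(2) by simp
  have "C * a ^ M * a ^ (N - M) = \<rho> ^ K N * v N"
    using MN by (simp add: eq mult.assoc power_add[symmetric])
  also have "\<dots> = (\<rho> ^ K M * v M) * \<rho> ^ (K N - K M)"
    using MN KMN by (simp add: power_add[symmetric])
  also have "\<dots> = C * a ^ M * \<rho> ^ (K N - K M)"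
    by (simp add: eq)
  finally have "a ^ (N - M) = \<rho> ^ (K N - K M)"
    using C a by simp
  then show ?thesis
    using MN by (intro exI[of _ "N - M"]) auto
qed

text \<open>
  Words over \<open>I\<close> form a tree in which the children of \<open>w\<close> are the words \<open>i # w\<close>. Every word carries a
  mass \<open>\<rho>^K \<cdot> v\<close> that is the sum of the masses of its children, with \<open>v\<close> from a finite set, and the
  multiplicative weight of the letters \<open>a\<close> is comparable to \<open>\<rho>^K\<close>. In the application the words label
  the pieces of the dust-like set, \<open>a i\<close> is \<open>r\<^sub>i^s\<close>, and the mass is that of the preimage of the piece.
\<close>

locale discrete_mass =
  fixes I :: "'i set" and a :: "'i \<Rightarrow> real" and \<rho> :: real
    and K :: "'i list \<Rightarrow> nat" and v :: "'i list \<Rightarrow> real" and V :: "real set" and L :: nat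
    and c1 c2 :: real
  assumes I: "finite I" "I \<noteq> {}" and a: "\<And>i. i \<in> I \<Longrightarrow> a i > 0" and \<rho>: "0 < \<rho>" "\<rho> < 1"
    and V: "finite V" "\<And>x. x \<in> V \<Longrightarrow> x > 0" and v: "\<And>w. w \<in> lists I \<Longrightarrow> v w \<in> V"
    and K_mono: "\<And>w i. w \<in> lists I \<Longrightarrow> i \<in> I \<Longrightarrow> K w \<le> K (i # w)"
    and K_bound: "\<And>w i. w \<in> lists I \<Longrightarrow> i \<in> I \<Longrightarrow> K (i # w) \<le> K w + L"
    and additive: "\<And>w. w \<in> lists I \<Longrightarrow> \<rho> ^ K w * v w = (\<Sum>i\<in>I. \<rho> ^ K (i # w) * v (i # w))"
    and c1: "0 < c1" "\<And>w. w \<in> lists I \<Longrightarrow> c1 * \<rho> ^ K w \<le> prod_list (map a w)"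
    and c2: "\<And>w. w \<in> lists I \<Longrightarrow> prod_list (map a w) \<le> c2 * \<rho> ^ K w"
begin

definition mass :: "'i list \<Rightarrow> real" where "mass w = \<rho> ^ K w * v w"
definition weight :: "'i list \<Rightarrow> real" where "weight w = prod_list (map a w)"

lemma weight_Cons [simp]: "weight (i # w) = a i * weight w"
  by (simp add: weight_def)

lemma weight_pos: "w \<in> lists I \<Longrightarrow> weight w > 0"
  by (induction w) (auto simp: weight_def a)

lemma mass_pos: "w \<in> lists I \<Longrightarrow> mass w > 0"
  using V v \<rho> by (simp add: mass_def)

lemma mass_additive: "w \<in> lists I \<Longrightarrow> mass w = (\<Sum>i\<in>I. mass (i # w))"
  using additive by (simp add: mass_def)

lemma mass_weight_comparable:
  obtains b1 b2 where "0 < b1" "0 < b2" "\<And>w. w \<in> lists I \<Longrightarrow> b1 * mass w \<le> weight w"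
    "\<And>w. w \<in> lists I \<Longrightarrow> weight w \<le> b2 * mass w"
proof -
  have Vne: "V \<noteq> {}"
    using v[of "[]"] by auto
  have Min: "Min V > 0" "Max V > 0"
    using V Vne by (auto simp: Min_gr_iff Max_gr_iff)
  have bounds: "Min V * \<rho> ^ K w \<le> mass w" "mass w \<le> Max V * \<rho> ^ K w" if "w \<in> lists I" for w
    using v[OF that] V \<rho> unfolding mass_def by (auto simp: mult.commute intro!: mult_left_mono)
  have c2pos: "c2 > 0"
  proof (rule zero_less_mult_pos2)
    have "1 \<le> c2 * \<rho> ^ K []"
      using c2[of "[]"] by simp
    then show "0 < c2 * \<rho> ^ K []"
      by simp
  qed (use \<rho> in simp)
  show thesis
  proof (rule that[of "c1 / Max V" "c2 / Min V"])
    fix w assume w: "w \<in> lists I"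
    have "c1 / Max V * mass w \<le> c1 / Max V * (Max V * \<rho> ^ K w)"
      using bounds(2)[OF w] Min c1 by (intro mult_left_mono) auto
    also have "\<dots> \<le> weight w"
      using c1(2)[OF w] Min by (simp add: weight_def)
    finally show "c1 / Max V * mass w \<le> weight w" .
    have "weight w \<le> c2 / Min V * (Min V * \<rho> ^ K w)"
      using c2[OF w] Min by (simp add: weight_def)
    also have "\<dots> \<le> c2 / Min V * mass w"
      using bounds(1)[OF w] Min c2pos by (intro mult_left_mono) auto
    finally show "weight w \<le> c2 / Min V * mass w" .
  qed (use Min c1 c2pos in auto)
qed

text \<open>
  Summing the comparison over the descendants \<open>N\<close> generations below \<open>w\<close> multiplies the weight by
  the \<open>N\<close>-th power of \<open>\<Sum>\<^sub>i a\<^sub>i\<close> and leaves the mass unchanged.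
\<close>

lemma mass_le_sum_power:
  assumes "\<And>w. w \<in> lists I \<Longrightarrow> b1 * mass w \<le> weight w" "w \<in> lists I"
  shows "b1 * mass w \<le> sum a I ^ N * weight w"
  using assms(2)
proof (induction N arbitrary: w)
  case 0
  then show ?case using assms(1) by simp
next
  case (Suc N)
  have "b1 * mass w = (\<Sum>i\<in>I. b1 * mass (i # w))"
    using mass_additive[OF Suc.prems] by (simp add: sum_distrib_left)
  also have "\<dots> \<le> (\<Sum>i\<in>I. sum a I ^ N * weight (i # w))"
    by (intro sum_mono Suc.IH) (use Suc.prems in auto)
  also have "\<dots> = sum a I ^ N * (\<Sum>i\<in>I. a i) * weight w"
    by (simp add: sum_distrib_left sum_distrib_right mult.assoc)
  finally show ?case
    by (simp add: mult.commute mult.left_commute)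
qed

lemma sum_power_le_mass:
  assumes "\<And>w. w \<in> lists I \<Longrightarrow> weight w \<le> b2 * mass w" "w \<in> lists I"
  shows "sum a I ^ N * weight w \<le> b2 * mass w"
  using assms(2)
proof (induction N arbitrary: w)
  case 0
  then show ?case using assms(1) by simp
next
  case (Suc N)
  have "sum a I ^ Suc N * weight w = sum a I ^ N * (\<Sum>i\<in>I. a i) * weight w"
    by (simp add: mult.commute mult.left_commute)
  also have "\<dots> = (\<Sum>i\<in>I. sum a I ^ N * weight (i # w))"
    by (simp add: sum_distrib_left sum_distrib_right mult.assoc)
  also have "\<dots> \<le> (\<Sum>i\<in>I. b2 * mass (i # w))"
    by (intro sum_mono Suc.IH) (use Suc.prems in auto)
  also have "\<dots> = b2 * mass w"
    using mass_additive[OF Suc.prems] by (simp add: sum_distrib_left)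
  finally show ?case .
qed

text \<open>
  The \<open>N\<close>-th powers of \<open>\<Sum>\<^sub>i a\<^sub>i\<close> stay between two positive constants.
\<close>

lemma sum_a: "sum a I = 1"
proof -
  obtain b1 b2 where b: "0 < b1" "0 < b2" "\<And>w. w \<in> lists I \<Longrightarrow> b1 * mass w \<le> weight w"
    "\<And>w. w \<in> lists I \<Longrightarrow> weight w \<le> b2 * mass w"
    using mass_weight_comparable by metis
  have m0: "mass [] > 0"
    by (simp add: mass_pos)
  have lo: "b1 * mass [] \<le> sum a I ^ N" and hi: "sum a I ^ N \<le> b2 * mass []" for N
    using mass_le_sum_power[of b1 "[]" N] sum_power_le_mass[of b2 "[]" N] b by (simp_all add: weight_def)
  have "\<not> sum a I < 1"
  proof
    assume "sum a I < 1"
    then obtain N where "sum a I ^ N < b1 * mass []"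
      using real_arch_pow_inv[of "b1 * mass []" "sum a I"] b m0 by auto
    then show False
      using lo[of N] by simp
  qed
  moreover have "\<not> sum a I > 1"
  proof
    assume "sum a I > 1"
    then obtain N where "b2 * mass [] < sum a I ^ N"
      using real_arch_pow by blast
    then show False
      using hi[of N] by simp
  qed
  ultimately show ?thesis
    by simp
qed

definition ratio :: "'i list \<Rightarrow> real" where "ratio w = weight w / mass w"

lemma ratio_pos: "w \<in> lists I \<Longrightarrow> ratio w > 0"
  by (simp add: ratio_def mass_pos weight_pos)

text \<open>
  The factor by which the ratio changes from \<open>w\<close> to a child depends only on the letter, the increment of
  \<open>K\<close> and the two values of \<open>v\<close>, each of which has finitely many possibilities.
\<close>

lemma ratio_steps_finite:
  "finite {ratio (i # w) / ratio w | i w. i \<in> I \<and> w \<in> lists I}" (is "finite ?D")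
proof -
  let ?R = "(\<lambda>(i, d, x, y). a i * x / (\<rho> ^ d * y)) ` (I \<times> {..L} \<times> V \<times> V)"
  have "?D \<subseteq> ?R"
  proof
    fix z assume "z \<in> ?D"
    then obtain i w where z: "z = ratio (i # w) / ratio w" and iw: "i \<in> I" "w \<in> lists I"
      by blast
    then have iw': "i # w \<in> lists I"
      by simp
    have "weight w > 0" "v w > 0" "v (i # w) > 0"
      using weight_pos iw V v iw' by blast+
    moreover have "\<rho> ^ K (i # w) = \<rho> ^ K w * \<rho> ^ (K (i # w) - K w)"
      using K_mono[OF iw(2,1)] by (simp add: power_add[symmetric])
    ultimately have "ratio (i # w) / ratio w = a i * v w / (\<rho> ^ (K (i # w) - K w) * v (i # w))"
      using \<rho> by (simp add: ratio_def mass_def field_simps)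
    moreover have "K (i # w) - K w \<in> {..L}"
      using K_bound[OF iw(2,1)] by simp
    ultimately show "z \<in> ?R"
      unfolding z using iw v[OF iw(2)] v[OF iw'] by (intro image_eqI[of _ _ "(i, K (i # w) - K w, v w, v (i # w))"]) auto
  qed
  moreover have "finite ?R"
    using I V by simp
  ultimately show ?thesis
    by (rule finite_subset)
qed

text \<open>
  Since only finitely many factors occur, those above \<open>1\<close> are at least some \<open>q > 1\<close>. Below a word whose
  ratio exceeds the supremum divided by \<open>q\<close> no factor can be larger than \<open>1\<close>. But \<open>\<Sum>\<^sub>i a\<^sub>i = 1\<close> makes
  the ratio of a word a weighted average of the ratios of its children, so all factors equal \<open>1\<close>, and the
  argument repeats at every descendant.
\<close>

lemma ratio_eventually_constant:
  obtains w where "w \<in> lists I" "\<And>u. u \<in> lists I \<Longrightarrow> ratio (u @ w) = ratio w"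
proof -
  obtain b1 b2 where b: "0 < b2" "\<And>w. w \<in> lists I \<Longrightarrow> weight w \<le> b2 * mass w"
    using mass_weight_comparable by metis
  let ?D = "{ratio (i # w) / ratio w | i w. i \<in> I \<and> w \<in> lists I}"
  define M where "M = (SUP w\<in>lists I. ratio w)"
  have bdd: "bdd_above (ratio ` lists I)"
    using b mass_pos by (intro bdd_aboveI2[of _ _ b2]) (simp add: ratio_def divide_le_eq)
  have le_M: "ratio w \<le> M" if "w \<in> lists I" for w
    unfolding M_def using bdd that by (rule cSUP_upper2) simp
  have "M > 0"
    using le_M[of "[]"] ratio_pos[of "[]"] by simp
  \<comment> \<open>Inserting \<open>2\<close> keeps the set nonempty, so that its minimum is meaningful.\<close>
  define D' where "D' = insert 2 {d \<in> ?D. d > 1}"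
  have fin: "finite D'" "D' \<noteq> {}"
    using ratio_steps_finite by (auto simp: D'_def)
  define q where "q = Min D'"
  have q1: "q > 1"
    unfolding q_def using fin by (subst Min_gr_iff) (auto simp: D'_def)
  have "M / q < M"
    using q1 \<open>M > 0\<close> by (simp add: divide_less_eq)
  then obtain w where w: "w \<in> lists I" "ratio w > M / q"
    unfolding M_def using bdd less_cSUP_iff[of "lists I" ratio] by blast
  have step: "ratio (i # u) = ratio u" if u: "u \<in> lists I" "ratio u > M / q" "i \<in> I" for i u
  proof -
    have le: "ratio (j # u) \<le> ratio u" if j: "j \<in> I" for j
    proof (rule ccontr)
      assume "\<not> ?thesis"
      then have "ratio (j # u) / ratio u > 1"
        using ratio_pos[OF u(1)] by simp
      then have "ratio (j # u) / ratio u \<in> D'"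
        unfolding D'_def using j u by blast
      then have "q \<le> ratio (j # u) / ratio u"
        unfolding q_def using fin by simp
      then have "q * ratio u \<le> ratio (j # u)"
        using ratio_pos[OF u(1)] by (simp add: pos_le_divide_eq)
      moreover have "M < q * ratio u"
        using u(2) q1 by (simp add: divide_less_eq mult.commute)
      ultimately show False
        using le_M[of "j # u"] j u by simp
    qed
    have le': "a j * mass u \<le> mass (j # u)" if j: "j \<in> I" for j
    proof -
      have "a j * weight u * mass u \<le> weight u * mass (j # u)"
        using le[OF j] mass_pos[of "j # u"] mass_pos[OF u(1)] j u(1)
        by (simp add: ratio_def divide_le_eq pos_le_divide_eq mult.commute)
      then have "weight u * (a j * mass u) \<le> weight u * mass (j # u)"
        by (simp add: ac_simps)
      then show ?thesis
        using weight_pos[OF u(1)] by simp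
    qed
    have "(\<Sum>j\<in>I. a j * mass u) = (\<Sum>j\<in>I. mass (j # u))"
      using mass_additive[OF u(1)] sum_a by (simp flip: sum_distrib_right)
    then have "a i * mass u = mass (i # u)"
      using sum_mono_inv[of "\<lambda>j. a j * mass u" I "\<lambda>j. mass (j # u)" i] le' I u by blast
    then show ?thesis
      using a[OF u(3)] by (simp add: ratio_def flip: \<open>a i * mass u = mass (i # u)\<close>)
  qed
  have "ratio (u @ w) = ratio w" if "u \<in> lists I" for u
    using that
  proof (induction u)
    case (Cons i u)
    then show ?case
      using step[of "u @ w" i] w by auto
  qed simp
  then show thesis
    using that w by blast
qed

lemma power_relation:
  assumes i: "i \<in> I"
  shows "\<exists>p\<ge>1. \<exists>e. a i ^ p = \<rho> ^ e"
proof -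
  obtain w where w: "w \<in> lists I" "\<And>u. u \<in> lists I \<Longrightarrow> ratio (u @ w) = ratio w"
    using ratio_eventually_constant by metis
  have lists: "replicate N i @ w \<in> lists I" "replicate N i \<in> lists I" for N
    using i w by (auto simp: in_lists_conv_set)
  have mass_eq: "mass (replicate N i @ w) = mass w * a i ^ N" for N
  proof -
    have "weight (replicate N i @ w) = a i ^ N * weight w"
      by (induction N) simp_all
    then show ?thesis
      using w(2)[OF lists(2)[of N]] mass_pos[OF w(1)] mass_pos[OF lists(1)[of N]] weight_pos[OF w(1)]
      by (simp add: ratio_def frac_eq_eq) (simp add: ac_simps)
  qed
  show ?thesis
  proof (rule commensurable_of_finite_quotients[where K = "\<lambda>N. K (replicate N i @ w)"
        and v = "\<lambda>N. v (replicate N i @ w)" and C = "mass w" and V = V])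
    show "mono (\<lambda>N. K (replicate N i @ w))"
    proof (rule mono_iff_le_Suc[THEN iffD2], rule allI)
      fix N show "K (replicate N i @ w) \<le> K (replicate (Suc N) i @ w)"
        using K_mono[OF lists(1)[of N] i] by simp
    qed
    show "\<rho> ^ K (replicate N i @ w) * v (replicate N i @ w) = mass w * a i ^ N" for N
      using mass_eq[of N] by (simp only: mass_def)
    show "v (replicate N i @ w) \<in> V" for N
      by (rule v[OF lists(1)])
  qed (use V a i \<rho> mass_pos[OF w(1)] in auto)
qed

end

section \<open>Counting endpoints of a self-similar set with exact overlaps\<close>

locale overlapping_system = quadratic_roots n m big small
  for n m :: nat and big small :: real +
  fixes l :: real and b :: "nat \<Rightarrow> real" and E :: "real set"
  assumes l: "0 < l" "2 * l < 1"
    and b_first: "b 1 = 0" and b_last: "b n = 1 - l" and b_mono: "strict_mono_on {1..n} b"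
    and gaps: "\<And>i. i \<in> {1..<n} \<Longrightarrow> b (Suc i) - b i = l * (1 - l) \<or> l \<le> b (Suc i) - b i"
    and overlaps: "card {i \<in> {1..<n}. b (Suc i) - b i = l * (1 - l)} = m"
    and E_compact: "compact E" "E \<noteq> {}" and E_eq: "E = (\<Union>i\<in>{1..n}. (\<lambda>x. l * x + b i) ` E)"
begin

lemma n_pos: "1 \<in> {1..n}" "n \<in> {1..n}"
  using m by auto

lemma two_overlaps: "l \<le> 2 * (l * (1 - l))" "l * (1 - l) < l" "0 < l * (1 - l)"
  using l mult_left_mono[of "2 * l" 1 l] by (auto simp: algebra_simps)

text \<open>
  Indices that are not neighbours are separated by at least two gaps, each of them at least \<open>l (1 - l)\<close>;
  because of \<open>2 l < 1\<close> the sum is at least \<open>l\<close>.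
\<close>

lemma b_gap:
  assumes "i \<in> {1..n}" "j \<in> {1..n}" "i < j"
  shows "b j - b i = l * (1 - l) \<and> j = Suc i \<or> l \<le> b j - b i"
proof (cases "j = Suc i")
  case True
  then show ?thesis
    using gaps[of i] assms by auto
next
  case False
  then obtain j' where j': "j = Suc j'" "i < j'"
    using assms by (cases j) auto
  have "l * (1 - l) \<le> b (Suc i) - b i"
    using gaps[of i] assms two_overlaps by auto
  moreover have "l * (1 - l) \<le> b j - b j'"
    using gaps[of j'] assms j' two_overlaps by auto
  moreover have "b (Suc i) \<le> b j'"
    using assms j' by (intro strict_mono_on_leD[OF b_mono]) auto
  ultimately show ?thesis
    using two_overlaps by linarith
qed

lemma b_gap_min:
  assumes "i \<in> {1..n}" "j \<in> {1..n}" "i < j"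
  shows "l * (1 - l) \<le> b j - b i"
  using b_gap[OF assms] two_overlaps by auto

lemma b_range: "i \<in> {1..n} \<Longrightarrow> 0 \<le> b i \<and> b i \<le> 1 - l"
  using strict_mono_on_leD[OF b_mono, of 1 i] strict_mono_on_leD[OF b_mono, of i n] b_first b_last n_pos
  by auto

lemma b_less_iff: "i \<in> {1..n} \<Longrightarrow> j \<in> {1..n} \<Longrightarrow> b i < b j \<longleftrightarrow> i < j"
  using b_mono by (metis strict_mono_on_less)

text \<open>
  The left endpoints of the intervals of level \<open>k\<close>, which have the form \<open>[a, a + l^k]\<close>. Words with the
  same interval are identified in this way, which is how exact overlaps are taken into account.
\<close>

fun ends :: "nat \<Rightarrow> real set" where
  "ends 0 = {0}"
| "ends (Suc k) = (\<lambda>(a, i). a + l ^ k * b i) ` (ends k \<times> {1..n})"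

lemma ends_finite: "finite (ends k)"
  by (induction k) auto

lemma ends_SucI: "a \<in> ends k \<Longrightarrow> i \<in> {1..n} \<Longrightarrow> a + l ^ k * b i \<in> ends (Suc k)"
  by (auto intro!: image_eqI[of _ _ "(a, i)"])

lemma ends_SucE:
  assumes "x \<in> ends (Suc k)"
  obtains a i where "x = a + l ^ k * b i" "a \<in> ends k" "i \<in> {1..n}"
  using assms by auto

lemma ends_addI: "a \<in> ends k \<Longrightarrow> z \<in> ends j \<Longrightarrow> a + l ^ k * z \<in> ends (k + j)"
proof (induction j arbitrary: z)
  case (Suc j)
  obtain y i where z: "z = y + l ^ j * b i" "y \<in> ends j" "i \<in> {1..n}"
    using Suc.prems(2) by (rule ends_SucE)
  then have "(a + l ^ k * y) + l ^ (k + j) * b i \<in> ends (Suc (k + j))"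
    using Suc by (intro ends_SucI) auto
  then show ?case
    by (simp add: z algebra_simps power_add)
qed simp

lemma ends_addE:
  assumes "x \<in> ends (k + j)"
  obtains a z where "x = a + l ^ k * z" "a \<in> ends k" "z \<in> ends j"
proof -
  have "\<exists>a z. x = a + l ^ k * z \<and> a \<in> ends k \<and> z \<in> ends j"
    using assms
  proof (induction j arbitrary: x)
    case (Suc j)
    obtain y i where x: "x = y + l ^ (k + j) * b i" "y \<in> ends (k + j)" "i \<in> {1..n}"
      using Suc.prems by (auto elim: ends_SucE)
    then obtain a z where "y = a + l ^ k * z" "a \<in> ends k" "z \<in> ends j"
      using Suc.IH by blast
    then show ?case
      using x ends_SucI[of z j i]
      by (intro exI[of _ a] exI[of _ "z + l ^ j * b i"]) (simp add: algebra_simps power_add)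
  qed auto
  then show thesis
    using that by blast
qed

lemma ends_range: "x \<in> ends k \<Longrightarrow> 0 \<le> x \<and> x + l ^ k \<le> 1"
proof (induction k arbitrary: x)
  case (Suc k)
  obtain a i where x: "x = a + l ^ k * b i" "a \<in> ends k" "i \<in> {1..n}"
    using Suc.prems by (rule ends_SucE)
  have "0 \<le> l ^ k * b i" "l ^ k * b i \<le> l ^ k * (1 - l)"
    using b_range[OF x(3)] l by auto
  then show ?case
    using Suc.IH[OF x(2)] by (simp add: x(1) algebra_simps)
qed simp

lemma ends_less_1: "x \<in> ends k \<Longrightarrow> x < 1"
  using ends_range[of x k] l zero_less_power[of l k] by linarith

text \<open>
  The overlap pattern of the first level persists at all levels. Overlapping intervals of level \<open>k\<close> have
  left endpoints at distance \<open>l^k (1 - l)\<close>, so the last child of the left one is the first child of the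
  right one. Two children of different parents are therefore children of a common parent as well, or at
  least two gaps apart, or their parents do not overlap.
\<close>

lemma ends_gap:
  assumes "x \<in> ends k" "y \<in> ends k" "x < y"
  shows "y - x = l ^ k * (1 - l) \<or> l ^ k \<le> y - x"
  using assms
proof (induction k arbitrary: x y)
  case (Suc k)
  obtain c i where x: "x = c + l ^ k * b i" "c \<in> ends k" "i \<in> {1..n}"
    using Suc.prems(1) by (rule ends_SucE)
  obtain d j where y: "y = d + l ^ k * b j" "d \<in> ends k" "j \<in> {1..n}"
    using Suc.prems(2) by (rule ends_SucE)
  have scale: "y - x = l ^ Suc k * (1 - l) \<or> l ^ Suc k \<le> y - x"
    if "y - x = l ^ k * e" "e = l * (1 - l) \<or> l \<le> e" for e
    using that(2)
  proof
    assume "l \<le> e"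
    then have "l ^ k * l \<le> l ^ k * e"
      using l by (intro mult_left_mono) auto
    then show ?thesis
      using that(1) by (simp add: mult.commute)
  qed (use that(1) in simp)
  have lk: "l ^ k > 0"
    using l by simp
  consider "c = d" | "c < d" | "d < c"
    by linarith
  then show ?case
  proof cases
    case 1
    then have "b i < b j"
      using \<open>x < y\<close> x y lk by simp
    then have "i < j"
      using b_less_iff x y by blast
    then show ?thesis
      using 1 x y b_gap[of i j] by (intro scale[of "b j - b i"]) (auto simp: algebra_simps)
  next
    case 2
    from Suc.IH[OF x(2) y(2) 2] show ?thesis
    proof
      \<comment> \<open>Overlapping parents: the distance of the children is that of \<open>b i\<close> and \<open>b n + b j\<close>, rescaled.\<close>
      assume cd: "d - c = l ^ k * (1 - l)"
      then have eq: "y - x = l ^ k * (b n + b j - b i)"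
        using x y cd by (simp add: b_last algebra_simps)
      then have pos: "0 < b n + b j - b i"
        using \<open>x < y\<close> lk by (metis diff_gt_0_iff_gt zero_less_mult_pos)
      have "b n + b j - b i = l * (1 - l) \<or> l \<le> b n + b j - b i"
      proof (cases "i = n \<or> j = 1")
        case True
        then show ?thesis
        proof
          assume "i = n"
          then show ?thesis
            using b_gap[of 1 j] y n_pos b_first pos by (cases "j = 1") auto
        next
          assume "j = 1"
          then show ?thesis
            using b_gap[of i n] x n_pos b_first pos by (cases "i = n") auto
        qed
      next
        case False
        then have "l * (1 - l) \<le> b j - b 1" "l * (1 - l) \<le> b n - b i"
          using x y n_pos by (auto intro!: b_gap_min)
        then show ?thesis
          using two_overlaps(1) b_first by linarith
      qed
      then show ?thesis
        using eq by (intro scale)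
    next
      assume cd: "l ^ k \<le> d - c"
      have "l ^ k * (b i - b j) \<le> l ^ k * (1 - l)"
        using b_range[OF x(3)] b_range[OF y(3)] lk by (intro mult_left_mono) auto
      then have "l ^ k * l \<le> y - x"
        using cd x y by (simp add: algebra_simps)
      then show ?thesis
        by (simp add: mult.commute)
    qed
  next
    case 3
    have "l ^ k * (1 - l) \<le> c - d"
    proof -
      have "l ^ k * (1 - l) \<le> l ^ k * 1"
        using lk l by (intro mult_left_mono) auto
      then show ?thesis
        using Suc.IH[OF y(2) x(2) 3] by auto
    qed
    moreover have "l ^ k * (b j - b i) \<le> l ^ k * (1 - l)"
      using b_range[OF x(3)] b_range[OF y(3)] lk by (intro mult_left_mono) auto
    ultimately have "y \<le> x"
      using x y by (simp add: algebra_simps)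
    then show ?thesis
      using \<open>x < y\<close> by simp
  qed
qed simp

lemma ends_gap_min:
  assumes "x \<in> ends k" "y \<in> ends k" "x < y"
  shows "l ^ k * (1 - l) \<le> y - x"
proof -
  have "l ^ k * (1 - l) \<le> l ^ k * 1"
    using l by (intro mult_left_mono) auto
  then show ?thesis
    using ends_gap[OF assms] by auto
qed

text \<open>
  The endpoints in the last interval \<open>[1 - l, 1]\<close> of level one are those generated by the last map, even
  though the last but one interval may reach into it: its endpoints there lie in its own last child, which
  coincides with the first child of the last interval.
\<close>

lemma ends_right_part:
  assumes "z \<in> ends (Suc j)" "1 - l \<le> z"
  shows "\<exists>y\<in>ends j. z = 1 - l + l * y"
  using assms
proof (induction j arbitrary: z)
  case 0
  then obtain i where "i \<in> {1..n}" "z = b i"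
    by auto
  then show ?case
    using b_range[of i] 0 by auto
next
  case (Suc j)
  have "z \<in> ends (1 + Suc j)"
    using Suc.prems by simp
  then obtain c y where z: "z = c + l ^ 1 * y" "c \<in> ends 1" "y \<in> ends (Suc j)"
    by (rule ends_addE)
  then obtain i where i: "c = b i" "i \<in> {1..n}"
    by auto
  show ?case
  proof (cases "i = n")
    case True
    then show ?thesis
      using z i b_last by auto
  next
    case False
    have "l * y < l * 1"
      using ends_less_1[OF z(3)] l by (intro mult_strict_left_mono) auto
    then have "b n - b i < l"
      using z i Suc.prems b_last by simp
    then have gap: "b n - b i = l * (1 - l)"
      using b_gap[of i n] i False by auto
    then have "l * (1 - l) \<le> l * y"
      using z i Suc.prems b_last by simp
    then have "1 - l \<le> y"
      using l by simp
    then obtain u where u: "u \<in> ends j" "y = 1 - l + l * u"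
      using Suc.IH z by blast
    have "0 + l ^ 1 * u \<in> ends (1 + j)"
      using u n_pos b_first by (intro ends_addI) (auto intro!: image_eqI[of _ _ "(0, 1)"])
    then show ?thesis
      using z i gap u b_last by (intro bexI[of _ "l * u"]) (auto simp: algebra_simps)
  qed
qed

text \<open>
  The next interval of level \<open>k\<close> meets \<open>[a, a + l^k]\<close> in an interval of level \<open>k + 1\<close>.
\<close>

definition overlapped :: "nat \<Rightarrow> real \<Rightarrow> bool" where
  "overlapped k a \<longleftrightarrow> a + l ^ k * (1 - l) \<in> ends k"

lemma card_ends_left_part:
  "card {z \<in> ends (Suc j). z < 1 - l} + card (ends j) = card (ends (Suc j))"
proof -
  have "{z \<in> ends (Suc j). \<not> z < 1 - l} = (\<lambda>y. 1 - l + l * y) ` ends j"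
  proof (intro equalityI subsetI)
    fix z assume "z \<in> (\<lambda>y. 1 - l + l * y) ` ends j"
    then obtain y where y: "y \<in> ends j" "z = 1 - l + l * y"
      by blast
    have "(1 - l) + l ^ 1 * y \<in> ends (1 + j)"
      using y n_pos b_last by (intro ends_addI) (auto intro!: image_eqI[of _ _ "(0, n)"])
    then show "z \<in> {z \<in> ends (Suc j). \<not> z < 1 - l}"
      using y ends_range[of y j] l by (simp add: not_less del: ends.simps)
  qed (use ends_right_part in \<open>force simp: not_less simp del: ends.simps\<close>)
  moreover have "inj_on (\<lambda>y. 1 - l + l * y) (ends j)"
    using l by (auto simp: inj_on_def)
  ultimately have "card {z \<in> ends (Suc j). \<not> z < 1 - l} = card (ends j)"
    by (simp add: card_image)
  moreover have "ends (Suc j) = {z \<in> ends (Suc j). z < 1 - l} \<union> {z \<in> ends (Suc j). \<not> z < 1 - l}"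
    by blast
  then have "card (ends (Suc j)) = card {z \<in> ends (Suc j). z < 1 - l} + card {z \<in> ends (Suc j). \<not> z < 1 - l}"
    using ends_finite[of "Suc j"] by (subst card_Un_disjoint[symmetric]) (auto simp del: ends.simps)
  ultimately show ?thesis
    by simp
qed

text \<open>
  Every endpoint is assigned to the rightmost interval of level \<open>k\<close> that generates it. An overlapped
  interval thereby loses the endpoints of its last child, which are assigned to its right neighbour; these
  number \<open>card (ends j)\<close>. The closure condition on \<open>U\<close> says that this neighbour belongs to \<open>U\<close> too.
\<close>

lemma card_refinement:
  assumes U: "U \<subseteq> ends k" and closed: "\<And>a. a \<in> U \<Longrightarrow> overlapped k a \<Longrightarrow> a + l ^ k * (1 - l) \<in> U"
  shows "int (card (\<Union>a\<in>U. (\<lambda>z. a + l ^ k * z) ` ends (Suc j)))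
    = int (card U) * int (card (ends (Suc j))) - int (card {a \<in> U. overlapped k a}) * int (card (ends j))"
proof -
  have lk: "l ^ k > 0"
    using l by simp
  define Z where "Z a = {z \<in> ends (Suc j). overlapped k a \<longrightarrow> z < 1 - l}" for a
  define Y where "Y a = (\<lambda>z. a + l ^ k * z) ` Z a" for a
  have finU: "finite U"
    using U ends_finite finite_subset by blast
  have finZ: "finite (Z a)" for a
    using ends_finite[of "Suc j"] unfolding Z_def by (rule finite_subset[rotated]) blast
  \<comment> \<open>\<open>Y a\<close> is the set of endpoints assigned to \<open>a\<close>. A point passed on to the right neighbour \<open>c\<close> lies in
    the first child of \<open>c\<close>, hence it is not passed on again, as \<open>l < 1 - l\<close>.\<close>
  have cover: "(\<Union>a\<in>U. (\<lambda>z. a + l ^ k * z) ` ends (Suc j)) = (\<Union>a\<in>U. Y a)"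
  proof (intro equalityI subsetI)
    fix x assume "x \<in> (\<Union>a\<in>U. (\<lambda>z. a + l ^ k * z) ` ends (Suc j))"
    then obtain a z where az: "a \<in> U" "z \<in> ends (Suc j)" "x = a + l ^ k * z"
      by blast
    show "x \<in> (\<Union>a\<in>U. Y a)"
    proof (cases "overlapped k a \<and> 1 - l \<le> z")
      case False
      then have "z \<in> Z a"
        using az by (auto simp: Z_def simp del: ends.simps)
      then show ?thesis
        unfolding Y_def using az by blast
    next
      case True
      define c where "c = a + l ^ k * (1 - l)"
      have "c \<in> U"
        using closed az True by (simp add: c_def)
      obtain y where y: "y \<in> ends j" "z = 1 - l + l * y"
        using ends_right_part az True by blast
      have "0 + l ^ 1 * y \<in> ends (1 + j)"
        using y n_pos b_first by (intro ends_addI) (auto intro!: image_eqI[of _ _ "(0, 1)"])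
      moreover have "l * y < 1 - l"
      proof -
        have "l * y < l * 1"
          using ends_less_1[OF y(1)] l by (intro mult_strict_left_mono) auto
        then show ?thesis
          using l by linarith
      qed
      ultimately have "l * y \<in> Z c"
        by (simp add: Z_def)
      then have "c + l ^ k * (l * y) \<in> Y c"
        unfolding Y_def by blast
      moreover have "x = c + l ^ k * (l * y)"
        by (simp add: az y c_def algebra_simps)
      ultimately show ?thesis
        using \<open>c \<in> U\<close> by blast
    qed
  next
    fix x assume "x \<in> (\<Union>a\<in>U. Y a)"
    then show "x \<in> (\<Union>a\<in>U. (\<lambda>z. a + l ^ k * z) ` ends (Suc j))"
      unfolding Y_def Z_def by blast
  qed
  \<comment> \<open>A common point of \<open>Y a\<close> and \<open>Y c\<close> would force \<open>c\<close> to be the neighbour overlapping \<open>a\<close>.\<close>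
  have disj_less: "Y a \<inter> Y c = {}" if ac: "a \<in> U" "c \<in> U" "a < c" for a c
  proof (rule ccontr)
    assume "Y a \<inter> Y c \<noteq> {}"
    then obtain y z where yz: "y \<in> Z a" "z \<in> Z c" "a + l ^ k * y = c + l ^ k * z"
      unfolding Y_def by blast
    have z0: "0 \<le> z" "y < 1"
      using yz(1,2) ends_range[of z "Suc j"] ends_less_1[of y "Suc j"] by (auto simp: Z_def simp del: ends.simps)
    have ca: "c - a = l ^ k * y - l ^ k * z"
      using yz by simp
    have "l ^ k * y < l ^ k * 1" "0 \<le> l ^ k * z"
      using z0 lk by (intro mult_strict_left_mono mult_nonneg_nonneg; simp)+
    then have "c - a < l ^ k"
      using ca by simp
    then have gap: "c - a = l ^ k * (1 - l)"
      using ends_gap[of a k c] ac U by force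
    then have "overlapped k a"
      unfolding overlapped_def using ac U by (metis add_diff_cancel_left' diff_add_cancel add.commute subsetD)
    then have "y < 1 - l"
      using yz by (simp add: Z_def)
    then have "l ^ k * y < l ^ k * (1 - l)"
      using lk by (intro mult_strict_left_mono) auto
    then show False
      using ca gap \<open>0 \<le> l ^ k * z\<close> by linarith
  qed
  have disj: "\<forall>a\<in>U. \<forall>c\<in>U. a \<noteq> c \<longrightarrow> Y a \<inter> Y c = {}"
    using disj_less by (metis inf_commute linorder_neqE_linordered_idom)
  have cardY: "int (card (Y a)) = int (card (ends (Suc j))) - (if overlapped k a then int (card (ends j)) else 0)" for a
  proof -
    have "inj_on (\<lambda>z. a + l ^ k * z) (Z a)"
      using l by (auto simp: inj_on_def)
    then have "card (Y a) = card (Z a)"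
      unfolding Y_def by (rule card_image)
    moreover have "card (Z a) = card (ends (Suc j))" if "\<not> overlapped k a"
      using that by (simp add: Z_def del: ends.simps)
    moreover have "card (Z a) + card (ends j) = card (ends (Suc j))" if "overlapped k a"
      using that card_ends_left_part[of j] by (simp add: Z_def del: ends.simps)
    ultimately show ?thesis
      by (cases "overlapped k a") auto
  qed
  have "card (\<Union>a\<in>U. Y a) = (\<Sum>a\<in>U. card (Y a))"
    using finU finZ disj by (intro card_UN_disjoint) (auto simp: Y_def)
  then have "int (card (\<Union>a\<in>U. Y a)) = (\<Sum>a\<in>U. int (card (Y a)))"
    by simp
  also have "\<dots> = int (card U) * int (card (ends (Suc j))) - (\<Sum>a\<in>U. if overlapped k a then int (card (ends j)) else 0)"
    by (simp add: cardY sum_subtractf)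
  also have "(\<Sum>a\<in>U. if overlapped k a then int (card (ends j)) else 0)
      = int (card {a \<in> U. overlapped k a}) * int (card (ends j))"
    using finU by (simp add: sum.If_cases Int_def)
  finally show ?thesis
    using cover by simp
qed

lemma ends_1: "ends 1 = b ` {1..n}"
proof -
  have "ends 1 = (\<lambda>(a, i). a + l ^ 0 * b i) ` ({0} \<times> {1..n})"
    by simp
  then show ?thesis
    by force
qed

lemma b_inj: "inj_on b {1..n}"
  using b_mono by (rule strict_mono_on_imp_inj_on)

lemma card_ends_1: "card (ends 1) = n"
  unfolding ends_1 card_image[OF b_inj] by simp

lemma card_overlapped_1: "card {a \<in> ends 1. overlapped 1 a} = m"
proof -
  have "{a \<in> ends 1. overlapped 1 a} = b ` {i \<in> {1..<n}. b (Suc i) - b i = l * (1 - l)}"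
  proof (intro equalityI subsetI)
    fix a assume "a \<in> {a \<in> ends 1. overlapped 1 a}"
    then obtain i j where ij: "i \<in> {1..n}" "a = b i" "j \<in> {1..n}" "b i + l * (1 - l) = b j"
      unfolding overlapped_def ends_1 by auto
    then have "b i < b j"
      using two_overlaps by linarith
    then have "i < j"
      using ij b_less_iff by blast
    then have "j = Suc i"
      using b_gap[of i j] ij two_overlaps by auto
    then show "a \<in> b ` {i \<in> {1..<n}. b (Suc i) - b i = l * (1 - l)}"
      using ij by auto
  next
    fix a assume "a \<in> b ` {i \<in> {1..<n}. b (Suc i) - b i = l * (1 - l)}"
    then obtain i where i: "i \<in> {1..<n}" "b i + l * (1 - l) = b (Suc i)" "a = b i"
      by (auto simp: algebra_simps)
    then show "a \<in> {a \<in> ends 1. overlapped 1 a}"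
      unfolding overlapped_def ends_1 by auto
  qed
  moreover have "inj_on b {i \<in> {1..<n}. b (Suc i) - b i = l * (1 - l)}"
    by (rule inj_on_subset[OF b_inj]) auto
  ultimately show ?thesis
    using overlaps by (simp add: card_image)
qed

text \<open>
  This is \<open>card_refinement\<close> for all intervals of level one, \<open>m\<close> of which are overlapped.
\<close>

lemma card_ends_rec:
  "int (card (ends (Suc (Suc j)))) = int n * int (card (ends (Suc j))) - int m * int (card (ends j))"
proof -
  have "ends (1 + Suc j) = (\<Union>a\<in>ends 1. (\<lambda>z. a + l ^ 1 * z) ` ends (Suc j))"
  proof (intro equalityI subsetI)
    fix x assume "x \<in> ends (1 + Suc j)"
    then obtain a z where "x = a + l ^ 1 * z" "a \<in> ends 1" "z \<in> ends (Suc j)"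
      by (rule ends_addE)
    then show "x \<in> (\<Union>a\<in>ends 1. (\<lambda>z. a + l ^ 1 * z) ` ends (Suc j))"
      by blast
  qed (use ends_addI[of _ 1 _ "Suc j"] in blast)
  then show ?thesis
    using card_refinement[of "ends 1" 1 j] card_ends_1 card_overlapped_1
    by (simp add: overlapped_def del: ends.simps)
qed

lemma card_ends: "real (card (ends j)) * (big - small) = big ^ Suc j - small ^ Suc j"
proof (induction j rule: induct_nat_012)
  case 0
  then show ?case by simp
next
  case 1
  have "real (card (ends (Suc 0))) = big + small"
    using card_ends_1 roots_sum by (simp del: ends.simps)
  then show ?case
    by (simp only:) (simp add: algebra_simps)
next
  case (ge2 j)
  have rec: "real (card (ends (Suc (Suc j)))) = real n * real (card (ends (Suc j))) - real m * real (card (ends j))"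
    using arg_cong[OF card_ends_rec[of j], of real_of_int] by simp
  have "real (card (ends (Suc (Suc j)))) * (big - small)
      = (big + small) * (real (card (ends (Suc j))) * (big - small)) - big * small * (real (card (ends j)) * (big - small))"
    unfolding rec roots_sum[symmetric] roots_prod[symmetric] by (simp only: algebra_simps)
  also have "\<dots> = (big + small) * (big ^ Suc (Suc j) - small ^ Suc (Suc j)) - big * small * (big ^ Suc j - small ^ Suc j)"
    by (simp only: ge2)
  also have "\<dots> = big ^ Suc (Suc (Suc j)) - small ^ Suc (Suc (Suc j))"
    by (simp add: algebra_simps)
  finally show ?case .
qed

text \<open>
  \<open>\<rho>\<close> is the mass of a piece of level one relative to that of \<open>E\<close>, and \<open>total\<close> is the mass of \<open>E\<close>.
\<close>

definition rho :: real where "rho = 1 / big"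

lemma rho: "0 < rho" "rho < 1"
  using big by (auto simp: rho_def)

definition total :: real where "total = big / (big - small)"

lemma total_pos: "total > 0"
  using big small by (simp add: total_def)

lemma card_ends_limit: "(\<lambda>j. rho ^ j * real (card (ends j))) \<longlonglongrightarrow> total"
proof -
  have bs: "big - small > 0" "big > 0"
    using big small by auto
  have eq: "rho ^ j * real (card (ends j)) = (big - small * (small / big) ^ j) / (big - small)" for j
  proof -
    have "real (card (ends j)) = (big ^ Suc j - small ^ Suc j) / (big - small)"
      using card_ends[of j] bs by (simp add: field_simps)
    moreover have "rho ^ j * (big ^ Suc j - small ^ Suc j) = big - small * (small / big) ^ j"
      using bs by (simp add: rho_def power_divide right_diff_distrib)
    ultimately show ?thesis
      by simp
  qed
  have "(\<lambda>j. (small / big) ^ j) \<longlonglongrightarrow> 0"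
    using big small by (intro LIMSEQ_realpow_zero) (auto simp: divide_less_eq)
  then have "(\<lambda>j. (big - small * (small / big) ^ j) / (big - small)) \<longlonglongrightarrow> (big - small * 0) / (big - small)"
    by (intro tendsto_intros) (use bs small in auto)
  then show ?thesis
    by (simp add: eq total_def)
qed

text \<open>
  The extreme points \<open>u\<close> and \<open>w\<close> of the compact set \<open>E\<close> satisfy \<open>u = l u\<close> and \<open>w \<le> l w + 1 - l\<close>.
\<close>

lemma E_range: "E \<subseteq> {0..1}" and zero_in_E: "0 \<in> E"
proof -
  obtain u where u: "u \<in> E" "\<And>x. x \<in> E \<Longrightarrow> u \<le> x"
    using compact_attains_inf[OF E_compact] by blast
  obtain w where w: "w \<in> E" "\<And>x. x \<in> E \<Longrightarrow> x \<le> w"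
    using compact_attains_sup[OF E_compact] by blast
  obtain i x where ix: "i \<in> {1..n}" "x \<in> E" "u = l * x + b i"
    using u(1) E_eq by blast
  have "l * u \<le> l * x"
    using u(2)[OF ix(2)] l by (intro mult_left_mono) auto
  then have "u \<ge> l * u"
    using b_range[OF ix(1)] ix by simp
  then have "(1 - l) * u \<ge> 0"
    by (simp add: algebra_simps)
  then have u0: "u \<ge> 0"
    using l by (simp add: zero_le_mult_iff)
  have "l * u + b 1 \<in> E"
    using u(1) n_pos E_eq by blast
  then have "u \<le> l * u"
    using u(2) b_first by simp
  then have "(1 - l) * u \<le> 0"
    by (simp add: algebra_simps)
  then have "u \<le> 0"
    using l by (simp add: mult_le_0_iff)
  then have "u = 0"
    using u0 by simp
  obtain j y where jy: "j \<in> {1..n}" "y \<in> E" "w = l * y + b j"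
    using w(1) E_eq by blast
  have "l * y \<le> l * w"
    using w(2)[OF jy(2)] l by (intro mult_left_mono) auto
  then have "w \<le> l * w + (1 - l)"
    using b_range[OF jy(1)] jy by simp
  then have "(1 - l) * w \<le> (1 - l) * 1"
    by (simp add: algebra_simps)
  then have "w \<le> 1"
    using l by simp
  then show "E \<subseteq> {0..1}"
    using u(2) w(2) \<open>u = 0\<close> by force
  show "0 \<in> E"
    using u(1) \<open>u = 0\<close> by simp
qed

lemma E_refine: "E = (\<Union>a\<in>ends k. (\<lambda>x. a + l ^ k * x) ` E)"
proof (induction k)
  case (Suc k)
  have "E = (\<Union>a\<in>ends k. (\<lambda>x. a + l ^ k * x) ` (\<Union>i\<in>{1..n}. (\<lambda>x. l * x + b i) ` E))"
    using Suc E_eq by simp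
  also have "\<dots> = (\<Union>a\<in>ends (Suc k). (\<lambda>x. a + l ^ Suc k * x) ` E)"
  proof (intro equalityI subsetI)
    fix x assume "x \<in> (\<Union>a\<in>ends k. (\<lambda>x. a + l ^ k * x) ` (\<Union>i\<in>{1..n}. (\<lambda>x. l * x + b i) ` E))"
    then obtain a i y where "a \<in> ends k" "i \<in> {1..n}" "y \<in> E" "x = a + l ^ k * (l * y + b i)"
      by blast
    then have "a + l ^ k * b i \<in> ends (Suc k)" "x = (a + l ^ k * b i) + l ^ Suc k * y"
      using ends_SucI by (auto simp: algebra_simps)
    then show "x \<in> (\<Union>a\<in>ends (Suc k). (\<lambda>x. a + l ^ Suc k * x) ` E)"
      using \<open>y \<in> E\<close> by blast
  next
    fix x assume "x \<in> (\<Union>a\<in>ends (Suc k). (\<lambda>x. a + l ^ Suc k * x) ` E)"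
    then obtain c y where c: "c \<in> ends (Suc k)" "y \<in> E" "x = c + l ^ Suc k * y"
      by blast
    obtain a i where a: "c = a + l ^ k * b i" "a \<in> ends k" "i \<in> {1..n}"
      using c(1) by (rule ends_SucE)
    then have "x = a + l ^ k * (l * y + b i)"
      using c by (simp add: algebra_simps)
    then show "x \<in> (\<Union>a\<in>ends k. (\<lambda>x. a + l ^ k * x) ` (\<Union>i\<in>{1..n}. (\<lambda>x. l * x + b i) ` E))"
      using a c by blast
  qed
  finally show ?case .
qed simp

lemma ends_subset_E: "ends k \<subseteq> E"
  using E_refine[of k] zero_in_E by force

text \<open>
  \<open>A\<close> is a union of pieces of level \<open>k\<close>.
\<close>

definition saturated :: "nat \<Rightarrow> real set \<Rightarrow> bool" where
  "saturated k A \<longleftrightarrow> A \<subseteq> E \<and> (\<forall>a\<in>ends k. (\<lambda>x. a + l ^ k * x) ` E \<subseteq> A \<or> (\<lambda>x. a + l ^ k * x) ` E \<inter> A = {})"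

text \<open>
  Since \<open>0 \<in> E\<close>, the endpoint \<open>a\<close> represents its piece.
\<close>

lemma saturated_iff:
  assumes "saturated k A" "a \<in> ends k" "x \<in> E"
  shows "a + l ^ k * x \<in> A \<longleftrightarrow> a \<in> A"
proof -
  let ?J = "(\<lambda>x. a + l ^ k * x) ` E"
  have x: "a + l ^ k * x \<in> ?J"
    using assms(3) by (rule imageI)
  have "a + l ^ k * 0 \<in> ?J"
    using zero_in_E by (rule imageI)
  then have a: "a \<in> ?J"
    by simp
  have "?J \<subseteq> A \<or> ?J \<inter> A = {}"
    using assms(1,2) unfolding saturated_def by blast
  then show ?thesis
    using a x by blast
qed

lemma saturated_refine:
  assumes A: "saturated k A"
  shows "ends (k + j) \<inter> A = (\<Union>a\<in>ends k \<inter> A. (\<lambda>z. a + l ^ k * z) ` ends j)"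
proof (intro equalityI subsetI)
  fix x assume x: "x \<in> ends (k + j) \<inter> A"
  then obtain a z where az: "x = a + l ^ k * z" "a \<in> ends k" "z \<in> ends j"
    using ends_addE by blast
  have "z \<in> E"
    using ends_subset_E az(3) by (rule subsetD)
  then have "a \<in> A"
    using saturated_iff[OF A az(2)] az(1) x by simp
  then show "x \<in> (\<Union>a\<in>ends k \<inter> A. (\<lambda>z. a + l ^ k * z) ` ends j)"
    using az by blast
next
  fix x assume "x \<in> (\<Union>a\<in>ends k \<inter> A. (\<lambda>z. a + l ^ k * z) ` ends j)"
  then obtain a z where az: "x = a + l ^ k * z" "a \<in> ends k" "a \<in> A" "z \<in> ends j"
    by blast
  have zE: "z \<in> E"
    using ends_subset_E az(4) by (rule subsetD)
  show "x \<in> ends (k + j) \<inter> A"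
    using saturated_iff[OF A az(2) zE] ends_addI[OF az(2,4)] az(1,3) by simp
qed

text \<open>
  Overlapping pieces have the left endpoint of the right one in common, so \<open>A\<close> contains both or neither.
\<close>

lemma saturated_overlap:
  assumes A: "saturated k A" and a: "a \<in> ends k \<inter> A" and ov: "overlapped k a"
  shows "a + l ^ k * (1 - l) \<in> ends k \<inter> A"
proof -
  have "1 - l \<in> ends 1"
    unfolding ends_1 using n_pos b_last by force
  then have "1 - l \<in> E"
    using ends_subset_E by blast
  then show ?thesis
    using saturated_iff[OF A, of a "1 - l"] a ov unfolding overlapped_def by blast
qed

text \<open>
  The mass of \<open>A\<close> in units of \<open>total \<cdot> rho^k\<close>: each endpoint of level \<open>k\<close> contributes \<open>1\<close>, less the
  share \<open>rho\<close> of its last child if that child is shared with the right neighbour.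
\<close>

definition normalized_mass :: "nat \<Rightarrow> real set \<Rightarrow> real" where
  "normalized_mass k A = real (card (ends k \<inter> A)) - rho * real (card {a \<in> ends k \<inter> A. overlapped k a})"

text \<open>
  By \<open>card_refinement\<close> the counts at levels beyond \<open>k\<close> are a fixed linear combination of the total
  counts at two consecutive levels. The sequence on the left does not mention \<open>k\<close>, which allows masses of
  sets that are saturated at different levels to be compared.
\<close>

lemma saturated_measure:
  assumes A: "saturated k A"
  shows "(\<lambda>j. rho ^ j * real (card (ends j \<inter> A))) \<longlonglongrightarrow> total * (rho ^ k * normalized_mass k A)"
proof -
  let ?p = "real (card (ends k \<inter> A))" and ?q = "real (card {a \<in> ends k \<inter> A. overlapped k a})"
  let ?N = "\<lambda>j. rho ^ j * real (card (ends j))"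
  have count: "real (card (ends (k + Suc j) \<inter> A)) = ?p * real (card (ends (Suc j))) - ?q * real (card (ends j))" for j
    using arg_cong[OF card_refinement[of "ends k \<inter> A" k j], of real_of_int] saturated_overlap[OF A]
    unfolding saturated_refine[OF A] by (simp del: ends.simps)
  have eq: "rho ^ (j + Suc k) * real (card (ends (j + Suc k) \<inter> A))
      = rho ^ k * (?p * ?N (Suc j) - rho * ?q * ?N j)" for j
  proof -
    have "j + Suc k = k + Suc j"
      by simp
    moreover have "rho ^ (k + Suc j) = rho ^ k * (rho * rho ^ j)"
      by (simp add: power_add)
    ultimately show ?thesis
      by (simp only: count power_Suc) (simp only: algebra_simps)
  qed
  have "(\<lambda>j. rho ^ k * (?p * ?N (Suc j) - rho * ?q * ?N j)) \<longlonglongrightarrow> rho ^ k * (?p * total - rho * ?q * total)"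
    by (intro tendsto_intros card_ends_limit LIMSEQ_Suc[OF card_ends_limit])
  then have "(\<lambda>j. rho ^ (j + Suc k) * real (card (ends (j + Suc k) \<inter> A))) \<longlonglongrightarrow> total * (rho ^ k * normalized_mass k A)"
    unfolding eq by (simp add: normalized_mass_def algebra_simps)
  then show ?thesis
    by (rule LIMSEQ_offset)
qed

end

text \<open>
  The points fall into different cells of the grid of mesh \<open>d\<close> that starts at the leftmost of them.
\<close>

lemma card_separated_le:
  fixes S :: "real set"
  assumes S: "finite S" and sep: "\<And>x y. x \<in> S \<Longrightarrow> y \<in> S \<Longrightarrow> x < y \<Longrightarrow> d \<le> y - x"
    and diam: "\<And>x y. x \<in> S \<Longrightarrow> y \<in> S \<Longrightarrow> y - x \<le> B * d" and d: "d > 0"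
  shows "card S \<le> nat \<lfloor>B\<rfloor> + 1"
proof (cases "S = {}")
  case False
  define f where "f x = nat \<lfloor>(x - Min S) / d\<rfloor>" for x
  have less: "f x < f y" if "x \<in> S" "y \<in> S" "x < y" for x y
  proof -
    have "((x - Min S) + d) / d \<le> (y - Min S) / d"
      using sep[OF that] d by (intro divide_right_mono) auto
    then have "(x - Min S) / d + 1 \<le> (y - Min S) / d"
      using d by (simp add: add_divide_distrib)
    then have "\<lfloor>(x - Min S) / d\<rfloor> + 1 \<le> \<lfloor>(y - Min S) / d\<rfloor>"
      by linarith
    moreover have "\<lfloor>(x - Min S) / d\<rfloor> \<ge> 0"
      using that S d by simp
    ultimately show ?thesis
      unfolding f_def by (subst nat_less_eq_zless) linarith+
  qed
  have "inj_on f S"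
    by (rule inj_onI) (metis less less_irrefl linorder_neqE_linordered_idom)
  moreover have "f ` S \<subseteq> {..nat \<lfloor>B\<rfloor>}"
  proof clarify
    fix x assume "x \<in> S"
    then have "(x - Min S) / d \<le> B"
      using diam[of "Min S" x] S False d by (simp add: field_simps)
    then show "f x \<le> nat \<lfloor>B\<rfloor>"
      unfolding f_def by (intro nat_mono floor_mono)
  qed
  ultimately show ?thesis
    using card_inj_on_le[of f S "{..nat \<lfloor>B\<rfloor>}"] by simp
qed simp

section \<open>Pieces of a dust-like set\<close>

locale dust_like_system =
  fixes t :: nat and S :: "nat \<Rightarrow> 'a::euclidean_space \<Rightarrow> 'a" and r :: "nat \<Rightarrow> real" and F :: "'a set"
  assumes r: "\<And>i. i \<in> {1..t} \<Longrightarrow> 0 < r i" "\<And>i. i \<in> {1..t} \<Longrightarrow> r i < 1"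
    and similitude: "\<And>i x y. i \<in> {1..t} \<Longrightarrow> dist (S i x) (S i y) = r i * dist x y"
    and F_compact: "compact F" "F \<noteq> {}" and F_eq: "F = (\<Union>i\<in>{1..t}. S i ` F)"
    and F_disjoint: "\<And>i j. i \<in> {1..t} \<Longrightarrow> j \<in> {1..t} \<Longrightarrow> i \<noteq> j \<Longrightarrow> S i ` F \<inter> S j ` F = {}"
begin

text \<open>
  The head of a word is the innermost map, so that the pieces of \<open>i # w\<close> subdivide the piece of \<open>w\<close>.
\<close>

fun word_map :: "nat list \<Rightarrow> 'a \<Rightarrow> 'a" where
  "word_map [] = id"
| "word_map (i # w) = word_map w \<circ> S i"

definition ratio_of :: "nat list \<Rightarrow> real" where "ratio_of w = prod_list (map r w)"

definition piece :: "nat list \<Rightarrow> 'a set" where "piece w = word_map w ` F"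

lemma ratio_of_simps [simp]: "ratio_of [] = 1" "ratio_of (i # w) = r i * ratio_of w"
  by (simp_all add: ratio_of_def)

lemma ratio_of_range: "w \<in> lists {1..t} \<Longrightarrow> 0 < ratio_of w \<and> ratio_of w \<le> 1"
proof (induction w)
  case (Cons i w)
  have "0 < r i" "r i < 1" "0 < ratio_of w" "ratio_of w \<le> 1"
    using Cons r by auto
  then show ?case
    using mult_mono[of "r i" 1 "ratio_of w" 1] by simp
qed simp

lemma word_map_dist: "w \<in> lists {1..t} \<Longrightarrow> dist (word_map w x) (word_map w y) = ratio_of w * dist x y"
  by (induction w arbitrary: x y) (simp_all add: similitude)

lemma word_map_inj: "w \<in> lists {1..t} \<Longrightarrow> inj (word_map w)"
  using word_map_dist[of w] ratio_of_range[of w] unfolding inj_def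
  by (metis dist_eq_0_iff less_irrefl mult_eq_0_iff)

lemma piece_Nil: "piece [] = F"
  by (simp add: piece_def)

lemma piece_Cons: "piece (i # w) = word_map w ` (S i ` F)"
  by (simp add: piece_def image_comp)

lemma piece_children: "piece w = (\<Union>i\<in>{1..t}. piece (i # w))"
proof -
  have "piece w = word_map w ` (\<Union>i\<in>{1..t}. S i ` F)"
    unfolding piece_def using F_eq by simp
  then show ?thesis
    by (simp only: piece_Cons image_UN)
qed

lemma piece_children_disjoint:
  assumes "w \<in> lists {1..t}" "i \<in> {1..t}" "j \<in> {1..t}" "i \<noteq> j"
  shows "piece (i # w) \<inter> piece (j # w) = {}"
  unfolding piece_Cons image_Int[OF word_map_inj[OF assms(1)], symmetric]
    F_disjoint[OF assms(2-4)] by simp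

lemma piece_subset_F: "w \<in> lists {1..t} \<Longrightarrow> piece w \<subseteq> F"
proof (induction w)
  case (Cons i w)
  then have "piece (i # w) \<subseteq> piece w"
    using piece_children[of w] by auto
  then show ?case
    using Cons by auto
qed (simp add: piece_Nil)

lemma S_continuous: "i \<in> {1..t} \<Longrightarrow> continuous_on F (S i)"
  by (rule lipschitz_on_continuous_on[of "r i"]) (auto simp: lipschitz_on_def similitude r less_imp_le)

lemma separation_exists:
  "\<exists>\<delta>>0. \<forall>i\<in>{1..t}. \<forall>j\<in>{1..t}. i \<noteq> j \<longrightarrow> (\<forall>x\<in>F. \<forall>y\<in>F. \<delta> \<le> dist (S i x) (S j y))"
proof -
  let ?Q = "{(i, j). i \<in> {1..t} \<and> j \<in> {1..t} \<and> i \<noteq> j}"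
  have "\<exists>d>0. \<forall>x\<in>F. \<forall>y\<in>F. d \<le> dist (S i x) (S j y)" if ij: "i \<in> {1..t}" "j \<in> {1..t}" "i \<noteq> j" for i j
  proof -
    have "compact (S i ` F)" "closed (S j ` F)"
      using F_compact S_continuous that by (auto intro!: compact_continuous_image compact_imp_closed)
    then obtain d where "d > 0" "\<forall>x\<in>S i ` F. \<forall>y\<in>S j ` F. d \<le> dist x y"
      using separate_compact_closed[OF _ _ F_disjoint[OF ij]] by metis
    then show ?thesis
      by blast
  qed
  then have "\<forall>q\<in>?Q. \<exists>d>0. \<forall>x\<in>F. \<forall>y\<in>F. d \<le> dist (S (fst q) x) (S (snd q) y)"
    by auto
  then obtain d where d: "\<And>q. q \<in> ?Q \<Longrightarrow> d q > 0"
    "\<And>q x y. q \<in> ?Q \<Longrightarrow> x \<in> F \<Longrightarrow> y \<in> F \<Longrightarrow> d q \<le> dist (S (fst q) x) (S (snd q) y)"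
    by (metis (no_types, lifting))
  have fin: "finite (insert 1 (d ` ?Q))"
    by (rule finite.insertI, rule finite_imageI, rule finite_subset[of _ "{1..t} \<times> {1..t}"]) auto
  show ?thesis
  proof (intro exI conjI ballI impI)
    show "Min (insert 1 (d ` ?Q)) > 0"
      using fin d(1) by (subst Min_gr_iff) auto
    fix i j x y assume ij: "i \<in> {1..t}" "j \<in> {1..t}" "i \<noteq> j" "x \<in> F" "y \<in> F"
    then have "Min (insert 1 (d ` ?Q)) \<le> d (i, j)"
      using fin by (intro Min_le) auto
    then show "Min (insert 1 (d ` ?Q)) \<le> dist (S i x) (S j y)"
      using d(2)[of "(i, j)" x y] ij by simp
  qed
qed

definition sep :: real where
  "sep = (SOME \<delta>. \<delta> > 0 \<and> (\<forall>i\<in>{1..t}. \<forall>j\<in>{1..t}. i \<noteq> j \<longrightarrow> (\<forall>x\<in>F. \<forall>y\<in>F. \<delta> \<le> dist (S i x) (S j y))))"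

lemma sep_pos: "sep > 0"
  and sep_le: "i \<in> {1..t} \<Longrightarrow> j \<in> {1..t} \<Longrightarrow> i \<noteq> j \<Longrightarrow> x \<in> F \<Longrightarrow> y \<in> F \<Longrightarrow> sep \<le> dist (S i x) (S j y)"
  using someI_ex[OF separation_exists] unfolding sep_def by blast+

text \<open>
  A point outside the piece of \<open>i # w\<close> lies outside the piece of \<open>w\<close>, or in a sibling; siblings are
  similar copies of distinct first-level pieces, scaled by \<open>ratio_of w\<close>.
\<close>

lemma piece_separated:
  assumes "w \<in> lists {1..t}" "x \<in> piece w" "y \<in> F - piece w"
  shows "sep * ratio_of w \<le> dist x y"
  using assms
proof (induction w)
  case Nil
  then show ?case by (simp add: piece_Nil)
next
  case (Cons i w)
  then have iw: "i \<in> {1..t}" "w \<in> lists {1..t}"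
    by auto
  show ?case
  proof (cases "y \<in> piece w")
    case True
    then obtain j where j: "j \<in> {1..t}" "y \<in> piece (j # w)"
      using piece_children[of w] by blast
    then have "j \<noteq> i"
      using Cons.prems by auto
    obtain x' y' where xy: "x' \<in> F" "x = word_map w (S i x')" "y' \<in> F" "y = word_map w (S j y')"
      using Cons.prems j unfolding piece_Cons by blast
    have "r i * sep \<le> 1 * sep"
      using r[OF iw(1)] sep_pos by (intro mult_right_mono) auto
    also have "\<dots> \<le> dist (S i x') (S j y')"
      using sep_le[of i j] iw j \<open>j \<noteq> i\<close> xy by auto
    finally have "ratio_of w * (r i * sep) \<le> ratio_of w * dist (S i x') (S j y')"
      using ratio_of_range[OF iw(2)] by (intro mult_left_mono) auto
    then show ?thesis
      using word_map_dist[OF iw(2)] xy by (simp add: ac_simps)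
  next
    case False
    have "x \<in> piece w"
      using Cons.prems piece_children[of w] iw by blast
    then have "sep * ratio_of w \<le> dist x y"
      using Cons.IH False Cons.prems iw by blast
    moreover have "r i * (sep * ratio_of w) \<le> 1 * (sep * ratio_of w)"
      using r[OF iw(1)] sep_pos ratio_of_range[OF iw(2)] by (intro mult_right_mono) auto
    ultimately show ?thesis
      by (simp add: ac_simps)
  qed
qed

end

section \<open>Transporting the mass to the dust-like set\<close>

locale lipschitz_image_dust_like =
  overlapping_system n m big small l b E + dust_like_system t S r F
  for n m :: nat and big small l :: real and b :: "nat \<Rightarrow> real" and E :: "real set"
    and t :: nat and S :: "nat \<Rightarrow> 'a::euclidean_space \<Rightarrow> 'a" and r :: "nat \<Rightarrow> real" and F :: "'a set" +
  fixes h :: "real \<Rightarrow> 'a" and C :: real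
  assumes C: "C > 0" and h: "bij_betw h E F"
    and h_lower: "\<And>x y. x \<in> E \<Longrightarrow> y \<in> E \<Longrightarrow> inverse C * dist x y \<le> dist (h x) (h y)"
    and h_upper: "\<And>x y. x \<in> E \<Longrightarrow> y \<in> E \<Longrightarrow> dist (h x) (h y) \<le> C * dist x y"
begin

text \<open>
  Preimages of a piece and of its complement are at least \<open>gap_const \<cdot> ratio_of w\<close> apart. Capping the
  constant at \<open>1\<close> ensures that \<open>level w\<close> is positive; the intervals one level earlier are then at least as
  long as the gap, which is where \<open>level_lower\<close> comes from.
\<close>

definition gap_const :: real where "gap_const = min 1 (sep / C)"

lemma gap_const: "0 < gap_const" "gap_const \<le> 1" "C * gap_const \<le> sep"
  using sep_pos C by (auto simp: gap_const_def min_def field_simps)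

definition preimage :: "nat list \<Rightarrow> real set" where "preimage w = {x \<in> E. h x \<in> piece w}"

text \<open>
  The first level whose intervals are shorter than the gap around the preimage of the piece of \<open>w\<close>.
\<close>

definition level :: "nat list \<Rightarrow> nat" where "level w = (LEAST k. l ^ k < gap_const * ratio_of w)"

context
  fixes w assumes w: "w \<in> lists {1..t}"
begin

lemma level_exists: "\<exists>k. l ^ k < gap_const * ratio_of w"
  using real_arch_pow_inv[of "gap_const * ratio_of w" l] gap_const ratio_of_range[OF w] l by auto

lemma level_upper: "l ^ level w < gap_const * ratio_of w"
  unfolding level_def using level_exists by (rule LeastI_ex)

lemma level_lower: "l * (gap_const * ratio_of w) \<le> l ^ level w"
proof (cases "level w")
  case 0
  have "gap_const * ratio_of w \<le> 1 * 1"
    using gap_const ratio_of_range[OF w] by (intro mult_mono) auto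
  then show ?thesis
    using level_upper 0 by simp
next
  case (Suc k)
  then have "\<not> l ^ k < gap_const * ratio_of w"
    unfolding level_def by (intro not_less_Least) simp
  then show ?thesis
    using l Suc by (simp add: mult_left_mono)
qed

text \<open>
  An interval of level \<open>level w\<close> is too short to bridge the gap between the preimage and the rest of \<open>E\<close>.
\<close>

lemma preimage_saturated: "saturated (level w) (preimage w)"
  unfolding saturated_def
proof (intro conjI ballI)
  show "preimage w \<subseteq> E"
    by (auto simp: preimage_def)
  fix a assume a: "a \<in> ends (level w)"
  let ?J = "(\<lambda>x. a + l ^ level w * x) ` E"
  have JE: "?J \<subseteq> E"
    using E_refine[of "level w"] a by blast
  have near: "dist x y \<le> l ^ level w" if "x \<in> ?J" "y \<in> ?J" for x y
  proof -
    obtain u v where uv: "u \<in> E" "v \<in> E" "x = a + l ^ level w * u" "y = a + l ^ level w * v"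
      using \<open>x \<in> ?J\<close> \<open>y \<in> ?J\<close> by blast
    then have "\<bar>u - v\<bar> \<le> 1"
    proof -
      have "u \<in> {0..1}" "v \<in> {0..1}"
        using uv E_range by blast+
      then show ?thesis
        by (simp add: abs_le_iff)
    qed
    then have "l ^ level w * \<bar>u - v\<bar> \<le> l ^ level w * 1"
      using l by (intro mult_left_mono) auto
    moreover have "dist x y = l ^ level w * \<bar>u - v\<bar>"
      using l by (simp add: uv dist_real_def abs_mult flip: right_diff_distrib)
    ultimately show ?thesis
      by simp
  qed
  show "?J \<subseteq> preimage w \<or> ?J \<inter> preimage w = {}"
  proof (rule ccontr)
    assume "\<not> ?thesis"
    then obtain x y where xy: "x \<in> ?J" "x \<in> preimage w" "y \<in> ?J" "y \<notin> preimage w"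
      by blast
    then have "x \<in> E" "y \<in> E" "h x \<in> piece w" "h y \<in> F - piece w"
      using JE bij_betwE[OF h] by (auto simp: preimage_def)
    then have "sep * ratio_of w \<le> C * dist x y"
      using piece_separated[OF w] h_upper[of x y] by force
    also have "\<dots> \<le> C * l ^ level w"
      using near xy C by (intro mult_left_mono) auto
    also have "\<dots> < C * (gap_const * ratio_of w)"
      using level_upper C by (intro mult_strict_left_mono) auto
    also have "\<dots> \<le> sep * ratio_of w"
      using mult_right_mono[OF gap_const(3), of "ratio_of w"] ratio_of_range[OF w] by (simp add: ac_simps)
    finally show False
      by simp
  qed
qed

lemma preimage_nonempty: "ends (level w) \<inter> preimage w \<noteq> {}"
proof -
  obtain y where "y \<in> F"
    using F_compact by blast
  then have "word_map w y \<in> piece w"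
    by (auto simp: piece_def)
  then have "word_map w y \<in> h ` E"
    using piece_subset_F[OF w] h by (auto simp: bij_betw_def)
  then obtain x where x: "x \<in> E" "h x \<in> piece w"
    using \<open>word_map w y \<in> piece w\<close> by auto
  then obtain a z where az: "a \<in> ends (level w)" "z \<in> E" "x = a + l ^ level w * z"
    using E_refine[of "level w"] by blast
  then have "a \<in> preimage w"
    using saturated_iff[OF preimage_saturated az(1,2)] x by (auto simp: preimage_def)
  then show ?thesis
    using az by blast
qed

end

definition diam_bound :: real where "diam_bound = (SOME D. \<forall>x\<in>F. \<forall>y\<in>F. dist x y \<le> D)"

lemma diam_bound: "x \<in> F \<Longrightarrow> y \<in> F \<Longrightarrow> dist x y \<le> diam_bound"
proof -
  have "\<exists>D. \<forall>x\<in>F. \<forall>y\<in>F. dist x y \<le> D"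
    using compact_imp_bounded[OF F_compact(1)] unfolding bounded_two_points by blast
  then have "\<forall>x\<in>F. \<forall>y\<in>F. dist x y \<le> diam_bound"
    unfolding diam_bound_def by (rule someI_ex)
  then show "x \<in> F \<Longrightarrow> y \<in> F \<Longrightarrow> dist x y \<le> diam_bound"
    by blast
qed

definition count_bound :: nat where
  "count_bound = nat \<lfloor>C * diam_bound / (l * gap_const * (1 - l))\<rfloor> + 1"

text \<open>
  The preimage has diameter at most of the order of \<open>ratio_of w\<close>, hence of the order of the length of the
  intervals at its level, while endpoints of that level are separated by a fixed fraction of this length.
\<close>

lemma card_preimage_le:
  assumes w: "w \<in> lists {1..t}"
  shows "card (ends (level w) \<inter> preimage w) \<le> count_bound"
  unfolding count_bound_def
proof (rule card_separated_le[where d = "l ^ level w * (1 - l)"])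
  show "finite (ends (level w) \<inter> preimage w)"
    using ends_finite by blast
  show "0 < l ^ level w * (1 - l)"
    using l by simp
  fix x y assume xy: "x \<in> ends (level w) \<inter> preimage w" "y \<in> ends (level w) \<inter> preimage w"
  show "x < y \<Longrightarrow> l ^ level w * (1 - l) \<le> y - x"
    using ends_gap_min xy by blast
  have E: "x \<in> E" "y \<in> E" "h x \<in> piece w" "h y \<in> piece w"
    using xy by (auto simp: preimage_def)
  then obtain u v where uv: "u \<in> F" "v \<in> F" "h x = word_map w u" "h y = word_map w v"
    unfolding piece_def by blast
  have D0: "0 \<le> diam_bound"
    using diam_bound[OF uv(1,2)] zero_le_dist[of u v] by linarith
  have "y - x \<le> dist x y"
    by (simp add: dist_real_def)
  also have "\<dots> \<le> C * dist (h x) (h y)"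
    using h_lower[OF E(1,2)] C by (simp add: field_simps)
  also have "\<dots> \<le> C * (ratio_of w * diam_bound)"
    unfolding uv word_map_dist[OF w] using diam_bound[OF uv(1,2)] C ratio_of_range[OF w]
    by (intro mult_left_mono) auto
  also have "\<dots> \<le> C * (l ^ level w / (l * gap_const) * diam_bound)"
    using level_lower[OF w] C D0 l gap_const
    by (intro mult_left_mono mult_right_mono) (auto simp: field_simps)
  also have "\<dots> = C * diam_bound / (l * gap_const * (1 - l)) * (l ^ level w * (1 - l))"
    using l gap_const by (simp add: field_simps)
  finally show "y - x \<le> C * diam_bound / (l * gap_const * (1 - l)) * (l ^ level w * (1 - l))" .
qed

text \<open>
  A finite set that contains the normalized masses of all preimages; \<open>p\<close> and \<open>q\<close> stand for the numbers of
  endpoints and of overlapped endpoints.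
\<close>

definition normalized_masses :: "real set" where
  "normalized_masses = (\<lambda>(p, q). real p - rho * real q) ` {(p, q). 1 \<le> p \<and> p \<le> count_bound \<and> q \<le> p}"

lemma normalized_masses_finite: "finite normalized_masses"
proof -
  have "finite {(p, q). 1 \<le> p \<and> p \<le> count_bound \<and> q \<le> p}"
    by (rule finite_subset[of _ "{..count_bound} \<times> {..count_bound}"]) auto
  then show ?thesis
    unfolding normalized_masses_def by blast
qed

lemma normalized_masses_pos: "x \<in> normalized_masses \<Longrightarrow> x > 0"
proof -
  assume "x \<in> normalized_masses"
  then obtain p q :: nat where pq: "1 \<le> p" "q \<le> p" "x = real p - rho * real q"
    unfolding normalized_masses_def by auto
  have "rho * real q \<le> rho * real p"
    using rho pq by (intro mult_left_mono) auto
  also have "\<dots> < 1 * real p"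
    using rho pq by (intro mult_strict_right_mono) auto
  finally show ?thesis
    using pq by simp
qed

lemma normalized_mass_mem:
  assumes w: "w \<in> lists {1..t}"
  shows "normalized_mass (level w) (preimage w) \<in> normalized_masses"
proof -
  let ?A = "ends (level w) \<inter> preimage w"
  have fin: "finite ?A"
    using ends_finite by blast
  then have "card {a \<in> ?A. overlapped (level w) a} \<le> card ?A"
    by (intro card_mono) auto
  moreover have "1 \<le> card ?A"
    using fin preimage_nonempty[OF w] by (simp add: Suc_le_eq card_gt_0_iff)
  ultimately show ?thesis
    unfolding normalized_masses_def normalized_mass_def using card_preimage_le[OF w]
    by (intro image_eqI[of _ _ "(card ?A, card {a \<in> ?A. overlapped (level w) a})"]) auto
qed

text \<open>
  Endpoint counts at a fixed level are additive over the children of \<open>w\<close>; this passes to the limit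
  although the preimages are saturated at different levels.
\<close>

lemma preimage_additive:
  assumes w: "w \<in> lists {1..t}"
  shows "rho ^ level w * normalized_mass (level w) (preimage w)
    = (\<Sum>i\<in>{1..t}. rho ^ level (i # w) * normalized_mass (level (i # w)) (preimage (i # w)))"
proof -
  have iw: "i # w \<in> lists {1..t}" if "i \<in> {1..t}" for i
    using w that by simp
  have "card (ends j \<inter> preimage w) = (\<Sum>i\<in>{1..t}. card (ends j \<inter> preimage (i # w)))" for j
  proof -
    have "ends j \<inter> preimage w = (\<Union>i\<in>{1..t}. ends j \<inter> preimage (i # w))"
      unfolding preimage_def using piece_children[of w] by blast
    also have "card \<dots> = (\<Sum>i\<in>{1..t}. card (ends j \<inter> preimage (i # w)))"
    proof (rule card_UN_disjoint)
      show "\<forall>i\<in>{1..t}. \<forall>k\<in>{1..t}. i \<noteq> k \<longrightarrow>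
        (ends j \<inter> preimage (i # w)) \<inter> (ends j \<inter> preimage (k # w)) = {}"
        unfolding preimage_def using piece_children_disjoint[OF w] by blast
    qed (use ends_finite in auto)
    finally show ?thesis .
  qed
  then have eq: "(\<lambda>j. rho ^ j * real (card (ends j \<inter> preimage w)))
      = (\<lambda>j. \<Sum>i\<in>{1..t}. rho ^ j * real (card (ends j \<inter> preimage (i # w))))"
    by (simp add: sum_distrib_left)
  have "(\<lambda>j. \<Sum>i\<in>{1..t}. rho ^ j * real (card (ends j \<inter> preimage (i # w))))
      \<longlonglongrightarrow> (\<Sum>i\<in>{1..t}. total * (rho ^ level (i # w) * normalized_mass (level (i # w)) (preimage (i # w))))"
    using saturated_measure[OF preimage_saturated[OF iw]] by (intro tendsto_sum) auto
  then have "total * (rho ^ level w * normalized_mass (level w) (preimage w))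
      = (\<Sum>i\<in>{1..t}. total * (rho ^ level (i # w) * normalized_mass (level (i # w)) (preimage (i # w))))"
    using saturated_measure[OF preimage_saturated[OF w]] unfolding eq by (rule LIMSEQ_unique[rotated])
  then show ?thesis
    using total_pos by (simp flip: sum_distrib_left)
qed

text \<open>
  The dimension \<open>s\<close> of \<open>E\<close>, characterized by \<open>l^s = rho\<close>.
\<close>

definition similarity_dim :: real where "similarity_dim = ln rho / ln l"

lemma similarity_dim: "similarity_dim > 0" "l powr similarity_dim = rho"
  using l rho by (auto simp: similarity_dim_def powr_def divide_neg_neg)

lemma ratio_of_powr:
  assumes "w \<in> lists {1..t}"
  shows "ratio_of w powr similarity_dim = prod_list (map (\<lambda>i. r i powr similarity_dim) w)"
  using assms
proof (induction w)
  case (Cons i w)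
  then show ?case
    using r[of i] ratio_of_range[of w] by (simp add: powr_mult)
qed simp

lemma power_level_powr: "(l ^ k) powr similarity_dim = rho ^ k"
proof -
  have "(l ^ k) powr similarity_dim = (l powr similarity_dim) ^ k"
    using l by (simp add: powr_powr mult.commute flip: powr_realpow)
  then show ?thesis
    by (simp add: similarity_dim)
qed

lemma discrete_mass_preimage:
  obtains L where "discrete_mass {1..t} (\<lambda>i. r i powr similarity_dim) rho level
    (\<lambda>w. normalized_mass (level w) (preimage w)) normalized_masses L (gap_const powr (- similarity_dim)) (gap_const powr (- similarity_dim) / rho)"
proof -
  have tne: "{1..t} \<noteq> {}"
    using F_eq F_compact by force
  define rmin where "rmin = Min (r ` {1..t})"
  have rmin: "0 < rmin" "\<And>i. i \<in> {1..t} \<Longrightarrow> rmin \<le> r i"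
    unfolding rmin_def using tne r by auto
  obtain L where L: "l ^ L < rmin"
    using real_arch_pow_inv[of rmin l] rmin l by auto
  have kd: "gap_const powr (- similarity_dim) * gap_const powr similarity_dim = 1" "gap_const powr similarity_dim > 0"
    using gap_const by (simp_all add: powr_minus)
  have "discrete_mass {1..t} (\<lambda>i. r i powr similarity_dim) rho level
    (\<lambda>w. normalized_mass (level w) (preimage w)) normalized_masses L (gap_const powr (- similarity_dim)) (gap_const powr (- similarity_dim) / rho)"
  proof
    show "level w \<le> level (i # w)" if "w \<in> lists {1..t}" "i \<in> {1..t}" for w i
    proof -
      have "l ^ level (i # w) < gap_const * ratio_of (i # w)"
        using that by (intro level_upper) auto
      also have "\<dots> \<le> gap_const * ratio_of w"
        using mult_right_mono[of "r i" 1 "ratio_of w"] ratio_of_range[OF that(1)] r[OF that(2)] gap_const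
        by (intro mult_left_mono) auto
      finally show ?thesis
        unfolding level_def[of w] by (rule Least_le)
    qed
    show "level (i # w) \<le> level w + L" if "w \<in> lists {1..t}" "i \<in> {1..t}" for w i
    proof -
      have "l ^ (level w + L) < (gap_const * ratio_of w) * rmin"
        unfolding power_add using level_upper[OF that(1)] L l gap_const ratio_of_range[OF that(1)]
        by (intro mult_strict_mono) auto
      also have "\<dots> \<le> (gap_const * ratio_of w) * r i"
        using rmin(2)[OF that(2)] gap_const ratio_of_range[OF that(1)] by (intro mult_left_mono) auto
      finally show ?thesis
        unfolding level_def[of "i # w"] by (intro Least_le) (simp add: ac_simps)
    qed
    show "gap_const powr (- similarity_dim) * rho ^ level w \<le> prod_list (map (\<lambda>i. r i powr similarity_dim) w)"
      if "w \<in> lists {1..t}" for w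
    proof -
      have "(l ^ level w) powr similarity_dim \<le> (gap_const * ratio_of w) powr similarity_dim"
        using level_upper[OF that] l similarity_dim by (intro powr_mono2) auto
      then have "rho ^ level w \<le> gap_const powr similarity_dim * ratio_of w powr similarity_dim"
        using gap_const ratio_of_range[OF that] by (simp add: power_level_powr powr_mult)
      then have "gap_const powr (- similarity_dim) * rho ^ level w \<le> gap_const powr (- similarity_dim) * (gap_const powr similarity_dim * ratio_of w powr similarity_dim)"
        by (intro mult_left_mono) auto
      then show ?thesis
        using kd by (simp add: ratio_of_powr[OF that] flip: mult.assoc)
    qed
    show "prod_list (map (\<lambda>i. r i powr similarity_dim) w) \<le> gap_const powr (- similarity_dim) / rho * rho ^ level w"
      if "w \<in> lists {1..t}" for w
    proof -
      have "(l * (gap_const * ratio_of w)) powr similarity_dim \<le> (l ^ level w) powr similarity_dim"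
        using level_lower[OF that] l similarity_dim gap_const ratio_of_range[OF that] by (intro powr_mono2) auto
      then have "rho * (gap_const powr similarity_dim * ratio_of w powr similarity_dim) \<le> rho ^ level w"
        using gap_const ratio_of_range[OF that] l by (simp add: power_level_powr powr_mult similarity_dim)
      then have "gap_const powr (- similarity_dim) / rho * (rho * (gap_const powr similarity_dim * ratio_of w powr similarity_dim))
          \<le> gap_const powr (- similarity_dim) / rho * rho ^ level w"
        using rho by (intro mult_left_mono) auto
      moreover have "gap_const powr (- similarity_dim) / rho * (rho * (gap_const powr similarity_dim * ratio_of w powr similarity_dim)) = ratio_of w powr similarity_dim"
        using rho kd(1) by (simp add: flip: mult.assoc)
      ultimately show ?thesis
        by (simp add: ratio_of_powr[OF that])
    qed
    show "0 < r i powr similarity_dim" if "i \<in> {1..t}" for i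
      using r(1)[OF that] by simp
  qed (use tne rho gap_const normalized_masses_finite normalized_masses_pos normalized_mass_mem preimage_additive in auto)
  then show thesis
    using that by blast
qed

text \<open>
  The exponent \<open>k\<close> is a common multiple of all exponents \<open>p i\<close> with \<open>(r\<^sub>i^s)^(p i) = rho^(e i)\<close>, doubled to
  make it at least \<open>2\<close>. Then each \<open>r\<^sub>i^s\<close> is a power of \<open>1 / y\<close> for the \<open>k\<close>-th root \<open>y\<close> of the large root.
\<close>

lemma P_power_reducible: "\<exists>k\<ge>2. \<not> irreducible (pcompose (P_poly n m) (monom 1 k))"
proof -
  let ?a = "\<lambda>i. r i powr similarity_dim"
  obtain L where "discrete_mass {1..t} ?a rho level
    (\<lambda>w. normalized_mass (level w) (preimage w)) normalized_masses L (gap_const powr (- similarity_dim)) (gap_const powr (- similarity_dim) / rho)"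
    by (rule discrete_mass_preimage)
  then interpret dm: discrete_mass "{1..t}" ?a rho level
    "\<lambda>w. normalized_mass (level w) (preimage w)" normalized_masses L "gap_const powr (- similarity_dim)" "gap_const powr (- similarity_dim) / rho" .
  have "\<forall>i\<in>{1..t}. \<exists>p e. 1 \<le> p \<and> ?a i ^ p = rho ^ e"
    using dm.power_relation by blast
  then obtain p e where p: "\<And>i. i \<in> {1..t} \<Longrightarrow> 1 \<le> (p i :: nat)"
    and pe: "\<And>i. i \<in> {1..t} \<Longrightarrow> ?a i ^ p i = rho ^ (e i :: nat)"
    by metis
  have a: "0 < ?a i" "?a i < 1" if "i \<in> {1..t}" for i
    using r[OF that] similarity_dim powr_less_mono2[of similarity_dim "r i" 1] by auto
  have e: "1 \<le> e i" if "i \<in> {1..t}" for i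
  proof (rule ccontr)
    assume "\<not> ?thesis"
    then have "e i = 0"
      by simp
    then have "?a i ^ p i = 1"
      using pe[OF that] by simp
    moreover have "?a i ^ p i < 1"
      using a[OF that] p[OF that] by (intro power_less_one_iff[THEN iffD2]) auto
    ultimately show False
      by simp
  qed
  define k where "k = 2 * (\<Prod>i\<in>{1..t}. p i)"
  have prod_pos: "(\<Prod>i\<in>{1..t}. p i) \<ge> 1"
    using p by (intro prod_ge_1) auto
  define f where "f i = e i * (k div p i)" for i
  define y where "y = root k big"
  have k2: "k \<ge> 2"
    using prod_pos by (simp add: k_def)
  have y: "y > 0" "y ^ k = big"
    using k2 big by (auto simp: y_def)
  have dvd: "p i dvd k" if "i \<in> {1..t}" for i
    unfolding k_def using that by (intro dvd_mult dvd_prodI) auto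
  have f: "(1 / y) ^ f i = ?a i" if i: "i \<in> {1..t}" for i
  proof -
    have "((1 / y) ^ f i) ^ k = ((1 / y) ^ k) ^ f i"
      by (simp add: mult.commute flip: power_mult)
    also have "(1 / y) ^ k = rho"
      by (simp add: rho_def power_one_over y)
    also have "rho ^ f i = (rho ^ e i) ^ (k div p i)"
      by (simp add: f_def power_mult)
    also have "\<dots> = ?a i ^ (p i * (k div p i))"
      by (simp add: power_mult flip: pe[OF i])
    also have "\<dots> = ?a i ^ k"
      using dvd[OF i] by simp
    finally show ?thesis
      using k2 y a[OF i] by (intro power_eq_imp_eq_base[of "(1 / y) ^ f i" k "?a i"]) auto
  qed
  have f1: "1 \<le> f i" if "i \<in> {1..t}" for i
  proof -
    have "k div p i \<noteq> 0"
      using dvd[OF that] k2 p[OF that] by (auto simp: div_eq_0_iff dest: dvd_imp_le)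
    then show ?thesis
      using e[OF that] by (simp add: f_def Suc_le_eq)
  qed
  have "\<not> irreducible (pcompose (P_poly n m) (monom 1 k))"
  proof (rule reducible_of_power_sum)
    show "(\<Sum>i\<in>{1..t}. (1 / y) ^ f i) = 1"
      using dm.sum_a by (simp add: f)
    show "{1..t} \<noteq> {}"
      by (rule dm.I(2))
  qed (use f1 k2 y in auto)
  then show ?thesis
    using k2 by blast
qed

end

section \<open>The theorem\<close>

lemma overlap_ratio_eq:
  assumes "0 < l" "b i < b (Suc i)"
  shows "overlap_ratio l b i = max 0 (b i + l - b (Suc i)) / l"
proof -
  have bi: "basic_interval l b j = {b j..b j + l}" for j
  proof -
    have "affine_map l b j = (\<lambda>x. l * x + b j)"
      by (rule ext) (simp add: affine_map_def)
    then show ?thesis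
      using image_affinity_atLeastAtMost[of l "b j" 0 1] assms by (simp add: basic_interval_def add.commute)
  qed
  have "basic_interval l b i \<inter> basic_interval l b (Suc i) = {b (Suc i)..b i + l}"
    using assms by (auto simp: bi)
  then show ?thesis
    using assms unfolding overlap_ratio_def bi[of i] by (auto simp: max_def measure_def)
qed

text \<open>
  The overlap ratios translate into the gaps of \<open>b\<close>. The bound \<open>2 l < 1\<close> comes from adding up the gaps:
  \<open>1 - l \<ge> (n - 1) l - m l^2\<close>, which together with \<open>m \<le> n - 2\<close> and \<open>n \<ge> 3\<close> fails for \<open>l \<ge> 1/2\<close>.
\<close>

lemma overlapping_system_of_class_A:
  assumes l: "0 < l" "l < 1" and m: "1 \<le> m" "m + 2 \<le> n" and E: "E \<in> class_A l n m"
    and roots: "quadratic_roots n m big small"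
  obtains b where "overlapping_system n m big small l b E"
proof -
  obtain b where b1: "b 1 = 0" and bn: "b n = 1 - l" and mono: "strict_mono_on {1..n} b"
    and ratio: "\<forall>i\<in>{1..<n}. basic_interval l b i \<inter> basic_interval l b (Suc i) \<noteq> {}
        \<longrightarrow> overlap_ratio l b i \<in> {0, l}"
    and card: "card {i \<in> {1..<n}. overlap_ratio l b i = l} = m"
    and attr: "attractor n (affine_map l b) E"
    using E unfolding class_A_def by blast
  have less: "b i < b (Suc i)" if "i \<in> {1..<n}" for i
    using mono that by (auto simp: strict_mono_on_def)
  have ratio_l: "overlap_ratio l b i = l \<longleftrightarrow> b (Suc i) - b i = l * (1 - l)" if "i \<in> {1..<n}" for i
  proof -
    have "overlap_ratio l b i = l \<longleftrightarrow> max 0 (b i + l - b (Suc i)) = l * l"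
      using l(1) by (simp add: overlap_ratio_eq[OF l(1) less[OF that]] nonzero_divide_eq_eq)
    moreover have "0 < l * l" "l * (1 - l) = l - l * l"
      using l(1) by (simp_all add: algebra_simps)
    ultimately show ?thesis
      by linarith
  qed
  have gaps: "b (Suc i) - b i = l * (1 - l) \<or> l \<le> b (Suc i) - b i" if i: "i \<in> {1..<n}" for i
  proof (cases "basic_interval l b i \<inter> basic_interval l b (Suc i) = {}")
    case True
    then have "overlap_ratio l b i = 0"
      by (simp add: overlap_ratio_def)
    then show ?thesis
      unfolding overlap_ratio_eq[OF l(1) less[OF i]] using l by (auto simp: max_def split: if_splits)
  next
    case False
    then consider "overlap_ratio l b i = 0" | "overlap_ratio l b i = l"
      using ratio i by blast
    then show ?thesis
    proof cases
      case 1
      then show ?thesis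
        unfolding overlap_ratio_eq[OF l(1) less[OF i]] using l by (auto simp: max_def split: if_splits)
    qed (use ratio_l[OF i] in simp)
  qed
  let ?O = "{i \<in> {1..<n}. b (Suc i) - b i = l * (1 - l)}"
  have "{i \<in> {1..<n}. overlap_ratio l b i = l} = ?O"
    using ratio_l by blast
  then have cardO: "card ?O = m"
    using card by simp
  have "1 - l = (\<Sum>i\<in>{1..<n}. b (Suc i) - b i)"
    using m b1 bn by (subst sum_Suc_diff') auto
  also have "\<dots> \<ge> (\<Sum>i\<in>{1..<n}. l - (if i \<in> ?O then l * l else 0))"
    using gaps l by (intro sum_mono) (auto simp: algebra_simps)
  also have "(\<Sum>i\<in>{1..<n}. l - (if i \<in> ?O then l * l else 0)) = real (n - 1) * l - real m * (l * l)"
  proof -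
    have "(\<Sum>i\<in>{1..<n}. if i \<in> ?O then l * l else 0) = real (card ?O) * (l * l)"
      by (simp add: sum.If_cases Int_absorb1 Int_def)
    then show ?thesis
      using cardO by (simp add: sum_subtractf)
  qed
  finally have total: "real (n - 1) * l - real m * (l * l) \<le> 1 - l" .
  have l2: "2 * l < 1"
  proof (rule ccontr)
    assume "\<not> ?thesis"
    then have l2: "1 \<le> 2 * l"
      by simp
    have "real n * l - real m * (l * l) \<le> 1"
      using total m by (simp add: of_nat_diff algebra_simps)
    moreover have "real m * (l * l) \<le> (real n - 2) * (l * l)"
      using m by (intro mult_right_mono) auto
    ultimately have "real n * (l * (1 - l)) + 2 * (l * l) \<le> 1"
      by (simp add: algebra_simps)
    moreover have "3 * (l * (1 - l)) \<le> real n * (l * (1 - l))"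
      using m l by (intro mult_right_mono) auto
    moreover have "l * l < l"
      using l by simp
    ultimately show False
      using l2 by (simp add: algebra_simps)
  qed
  interpret quadratic_roots n m big small
    by (rule roots)
  have "overlapping_system n m big small l b E"
    using l l2 b1 bn mono gaps cardO attr
    by unfold_locales (auto simp: attractor_def affine_map_def[abs_def])
  then show thesis
    using that by blast
qed

lemma dust_like_system_exists:
  assumes "dust_like_self_similar F"
  obtains t S r where "dust_like_system t S r F"
proof -
  obtain t S where S: "\<forall>i\<in>{1..t}. contractive_similitude (S i)" and attr: "attractor t S F"
    and disj: "\<forall>i\<in>{1..t}. \<forall>j\<in>{1..t}. i \<noteq> j \<longrightarrow> S i ` F \<inter> S j ` F = {}"
    using assms unfolding dust_like_self_similar_def by blast
  obtain r where "\<And>i. i \<in> {1..t} \<Longrightarrow> 0 < r i \<and> r i < 1 \<and> (\<forall>x y. dist (S i x) (S i y) = r i * dist x y)"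
    using S unfolding contractive_similitude_def by metis
  then have "dust_like_system t S r F"
    using attr disj by unfold_locales (auto simp: attractor_def)
  then show thesis
    using that by blast
qed

theorem theorem1:
  fixes l :: real and m n :: nat
    and E :: "real set" and F :: "'a::euclidean_space set"
  assumes "0 < l" "l < 1"
    and "1 \<le> m" "m + 2 \<le> n"
    and "E \<in> class_A l n m"
    and "dust_like_self_similar F"
    and "lipschitz_equivalent E F"
  shows "(\<exists>k\<ge>2. \<not> irreducible (pcompose (P_poly n m) (monom 1 k))) \<and>
         m \<in> {a ^ i | a i :: nat. a \<ge> 1 \<and> i \<ge> 2}"
proof -
  obtain big small where roots: "quadratic_roots n m big small"
    using quadratic_roots_exist assms(3,4) by blast
  then interpret quadratic_roots n m big small .
  obtain b where os: "overlapping_system n m big small l b E"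
    using overlapping_system_of_class_A[OF assms(1-5) roots] by blast
  obtain t S r where ds: "dust_like_system t S r F"
    using dust_like_system_exists[OF assms(6)] by blast
  obtain h C where "C > 0" "bij_betw h E F"
    "\<And>x y. x \<in> E \<Longrightarrow> y \<in> E \<Longrightarrow> inverse C * dist x y \<le> dist (h x) (h y) \<and> dist (h x) (h y) \<le> C * dist x y"
    using assms(7) unfolding lipschitz_equivalent_def by blast
  then have "lipschitz_image_dust_like n m big small l b E t S r F h C"
    using os ds by (intro lipschitz_image_dust_like.intro lipschitz_image_dust_like_axioms.intro) auto
  then interpret lipschitz_image_dust_like n m big small l b E t S r F h C .
  obtain k where k: "k \<ge> 2" "\<not> irreducible (pcompose (P_poly n m) (monom 1 k))"
    using P_power_reducible by blast
  have "1 \<le> k"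
    using k(1) by simp
  then have "\<exists>e i. m = e ^ i \<and> e \<ge> 1 \<and> i \<ge> 2"
    using k(2) by (rule perfect_power_of_reducible)
  then show ?thesis
    using k by blast
qed

end
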